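(* (In $\mathsf{ZF}+\mathsf{DC}$.) If $V$ is a $\mathbb{Q}$-vector space that has a basis, then $V\not\to(\mathrm{uncountable})^{\operatorname{FS}}_{2}$. That is, there exists a colouring $c:V\to 2$ such that there is no uncountable set $X\subseteq V$ for which $\operatorname{FS}(X)$ is $c$-monochromatic.
   Context: The base theory is $\mathsf{ZF}$ together with the Axiom of Dependent Choice $\mathsf{DC}$; the full Axiom of Choice is not assumed. The basis of $V$ is a Hamel basis over $\mathbb{Q}$, not assumed well-orderable. For $X\subseteq V$, $\operatorname{FS}(X)=\{\sum_{a\in F}a : F\subseteq X \text{ finite and nonempty}\}$. A set is $c$-monochromatic if $c$ is constant on it. A set is uncountable if it does not inject into $\omega$. *)

theory Defs
  imports "HOL-Algebra.Module"
begin

text \<open>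
  HOL itself has a choice operator, so a statement about arbitrary HOL types and HOL sets would be a
  statement of ZFC. To say that something holds in ZF + DC, we speak about an arbitrary structure
  \<open>('m, E)\<close> for the language of set theory that satisfies the axioms of ZF and DC. By the
  completeness theorem, truth in all these structures is provability in ZF + DC. No assumption is
  made that the structure is well-founded or transitive, or that its natural numbers are standard.

  Objects of type \<open>'m\<close> are the sets of the structure. All set-theoretic notions below are
  interpreted in the structure: their quantifiers range over \<open>'m\<close>, and functions, finite sets,
  natural numbers and countings are elements of \<open>'m\<close>. Definite descriptions abbreviate
  first-order formulas, since the described object exists uniquely whenever it is used.
\<close>

datatype fm = Mem nat nat | Eq nat nat | Neg fm | And fm fm | All nat fm

primrec sat :: "('m \<Rightarrow> 'm \<Rightarrow> bool) \<Rightarrow> (nat \<Rightarrow> 'm) \<Rightarrow> fm \<Rightarrow> bool" where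
  "sat E s (Mem i j) \<longleftrightarrow> E (s i) (s j)"
| "sat E s (Eq i j) \<longleftrightarrow> s i = s j"
| "sat E s (Neg p) \<longleftrightarrow> \<not> sat E s p"
| "sat E s (And p q) \<longleftrightarrow> sat E s p \<and> sat E s q"
| "sat E s (All i p) \<longleftrightarrow> (\<forall>x. sat E (s(i := x)) p)"

context
  fixes E :: "'m \<Rightarrow> 'm \<Rightarrow> bool"  (infix \<open>\<^bold>\<in>\<close> 50)
begin

definition is_subset :: "'m \<Rightarrow> 'm \<Rightarrow> bool"  (infix \<open>\<^bold>\<subseteq>\<close> 50) where
  "a \<^bold>\<subseteq> b \<longleftrightarrow> (\<forall>x. x \<^bold>\<in> a \<longrightarrow> x \<^bold>\<in> b)"

definition extensionality :: bool where
  "extensionality \<longleftrightarrow> (\<forall>a b. (\<forall>x. x \<^bold>\<in> a \<longleftrightarrow> x \<^bold>\<in> b) \<longrightarrow> a = b)"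

definition foundation :: bool where
  "foundation \<longleftrightarrow> (\<forall>a. (\<exists>x. x \<^bold>\<in> a) \<longrightarrow> (\<exists>x. x \<^bold>\<in> a \<and> \<not> (\<exists>y. y \<^bold>\<in> x \<and> y \<^bold>\<in> a)))"

definition pairing :: bool where
  "pairing \<longleftrightarrow> (\<forall>a b. \<exists>c. \<forall>x. x \<^bold>\<in> c \<longleftrightarrow> x = a \<or> x = b)"

definition union :: bool where
  "union \<longleftrightarrow> (\<forall>a. \<exists>u. \<forall>x. x \<^bold>\<in> u \<longleftrightarrow> (\<exists>y. x \<^bold>\<in> y \<and> y \<^bold>\<in> a))"

definition power_set :: bool where
  "power_set \<longleftrightarrow> (\<forall>a. \<exists>p. \<forall>x. x \<^bold>\<in> p \<longleftrightarrow> x \<^bold>\<subseteq> a)"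

definition infinity :: bool where
  "infinity \<longleftrightarrow>
     (\<exists>w. (\<exists>z. z \<^bold>\<in> w \<and> (\<forall>x. \<not> x \<^bold>\<in> z)) \<and>
          (\<forall>n. n \<^bold>\<in> w \<longrightarrow> (\<exists>m. m \<^bold>\<in> w \<and> (\<forall>x. x \<^bold>\<in> m \<longleftrightarrow> x \<^bold>\<in> n \<or> x = n))))"

text \<open>
  In the two schemas the assignment \<open>s\<close> supplies the parameters of the formula. The set whose
  existence is asserted is not among them, which is the usual freeness condition.
\<close>

definition separation :: bool where
  "separation \<longleftrightarrow> (\<forall>\<phi> s i a. \<exists>b. \<forall>x. x \<^bold>\<in> b \<longleftrightarrow> x \<^bold>\<in> a \<and> sat (\<^bold>\<in>) (s(i := x)) \<phi>)"

definition replacement :: bool where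
  "replacement \<longleftrightarrow>
     (\<forall>\<phi> s i j a. i \<noteq> j \<longrightarrow>
        (\<forall>x. x \<^bold>\<in> a \<longrightarrow>
           (\<forall>y y'. sat (\<^bold>\<in>) (s(i := x, j := y)) \<phi> \<and> sat (\<^bold>\<in>) (s(i := x, j := y')) \<phi> \<longrightarrow> y = y')) \<longrightarrow>
        (\<exists>b. \<forall>y. y \<^bold>\<in> b \<longleftrightarrow> (\<exists>x. x \<^bold>\<in> a \<and> sat (\<^bold>\<in>) (s(i := x, j := y)) \<phi>)))"

definition ZF :: bool where
  "ZF \<longleftrightarrow> extensionality \<and> foundation \<and> pairing \<and> union \<and> power_set \<and> infinity \<and>
     separation \<and> replacement"

definition emp :: 'm where
  "emp = (THE z. \<forall>x. \<not> x \<^bold>\<in> z)"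

definition upair :: "'m \<Rightarrow> 'm \<Rightarrow> 'm" where
  "upair a b = (THE z. \<forall>x. x \<^bold>\<in> z \<longleftrightarrow> x = a \<or> x = b)"

definition opair :: "'m \<Rightarrow> 'm \<Rightarrow> 'm" where
  "opair a b = upair (upair a a) (upair a b)"

definition cprod :: "'m \<Rightarrow> 'm \<Rightarrow> 'm" where
  "cprod A B = (THE P. \<forall>z. z \<^bold>\<in> P \<longleftrightarrow> (\<exists>a b. a \<^bold>\<in> A \<and> b \<^bold>\<in> B \<and> z = opair a b))"

definition is_fun :: "'m \<Rightarrow> 'm \<Rightarrow> 'm \<Rightarrow> bool" where
  "is_fun f A B \<longleftrightarrow> f \<^bold>\<subseteq> cprod A B \<and> (\<forall>x. x \<^bold>\<in> A \<longrightarrow> (\<exists>!y. opair x y \<^bold>\<in> f))"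

definition app :: "'m \<Rightarrow> 'm \<Rightarrow> 'm" where
  "app f x = (THE y. opair x y \<^bold>\<in> f)"

definition app2 :: "'m \<Rightarrow> 'm \<Rightarrow> 'm \<Rightarrow> 'm" where
  "app2 f x y = app f (opair x y)"

definition is_inj :: "'m \<Rightarrow> 'm \<Rightarrow> 'm \<Rightarrow> bool" where
  "is_inj f A B \<longleftrightarrow> is_fun f A B \<and>
     (\<forall>x y. x \<^bold>\<in> A \<and> y \<^bold>\<in> A \<and> app f x = app f y \<longrightarrow> x = y)"

definition is_bij :: "'m \<Rightarrow> 'm \<Rightarrow> 'm \<Rightarrow> bool" where
  "is_bij f A B \<longleftrightarrow> is_inj f A B \<and> (\<forall>y. y \<^bold>\<in> B \<longrightarrow> (\<exists>x. x \<^bold>\<in> A \<and> app f x = y))"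

definition succ :: "'m \<Rightarrow> 'm" where
  "succ n = (THE z. \<forall>x. x \<^bold>\<in> z \<longleftrightarrow> x \<^bold>\<in> n \<or> x = n)"

definition is_inductive :: "'m \<Rightarrow> bool" where
  "is_inductive w \<longleftrightarrow> emp \<^bold>\<in> w \<and> (\<forall>n. n \<^bold>\<in> w \<longrightarrow> succ n \<^bold>\<in> w)"

definition omega :: 'm where
  "omega = (THE w. is_inductive w \<and> (\<forall>w'. is_inductive w' \<longrightarrow> w \<^bold>\<subseteq> w'))"

definition two :: 'm where
  "two = succ (succ emp)"

definition uncountable :: "'m \<Rightarrow> bool" where
  "uncountable X \<longleftrightarrow> \<not> (\<exists>f. is_inj f X omega)"

definition DC :: bool where
  "DC \<longleftrightarrow> (\<forall>A R. (\<exists>x. x \<^bold>\<in> A) \<and> (\<forall>x. x \<^bold>\<in> A \<longrightarrow> (\<exists>y. y \<^bold>\<in> A \<and> opair x y \<^bold>\<in> R)) \<longrightarrow>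
     (\<exists>f. is_fun f omega A \<and> (\<forall>n. n \<^bold>\<in> omega \<longrightarrow> opair (app f n) (app f (succ n)) \<^bold>\<in> R)))"

text \<open>
  \<open>K\<close>, \<open>pK\<close>, \<open>tK\<close>, \<open>zK\<close>, \<open>eK\<close> are the carrier, addition, multiplication, zero and one of the
  scalars, and \<open>V\<close>, \<open>pV\<close>, \<open>zV\<close>, \<open>sV\<close> the carrier, addition, zero and scalar multiplication of the
  vector space, all of them sets of the structure. The records give HOL-Algebra access to them;
  its axioms for fields and modules quantify over elements of the carriers only, so they are the
  internal ones.
\<close>

definition scalars :: "'m \<Rightarrow> 'm \<Rightarrow> 'm \<Rightarrow> 'm \<Rightarrow> 'm \<Rightarrow> 'm ring" where
  "scalars K pK tK zK eK =
     \<lparr>carrier = {x. x \<^bold>\<in> K}, mult = app2 tK, one = eK, zero = zK, add = app2 pK\<rparr>"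

text \<open>
  Module records extend ring records; the predicate \<^const>\<open>module\<close> does not look at the fields
  \<open>mult\<close> and \<open>one\<close> of its second argument.
\<close>

definition vectors :: "'m \<Rightarrow> 'm \<Rightarrow> 'm \<Rightarrow> 'm \<Rightarrow> ('m, 'm) module" where
  "vectors V pV zV sV =
     \<lparr>carrier = {x. x \<^bold>\<in> V}, mult = (\<lambda>_ _. zV), one = zV, zero = zV, add = app2 pV, smult = app2 sV\<rparr>"

text \<open>
  The field of rational numbers, up to isomorphism: a field into which the natural numbers embed by
  \<open>n \<mapsto> 1 + \<dots> + 1\<close>, and whose elements are the fractions \<open>(l - m) / n\<close> with natural numbers
  \<open>l\<close>, \<open>m\<close> and \<open>n \<noteq> 0\<close>.
\<close>

definition is_rationals :: "'m \<Rightarrow> 'm \<Rightarrow> 'm \<Rightarrow> 'm \<Rightarrow> 'm \<Rightarrow> bool" where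
  "is_rationals K pK tK zK eK \<longleftrightarrow>
     is_fun pK (cprod K K) K \<and> is_fun tK (cprod K K) K \<and>
     (let Q = scalars K pK tK zK eK in
       field Q \<and>
       (\<exists>\<iota>. is_fun \<iota> omega K \<and> app \<iota> emp = \<zero>\<^bsub>Q\<^esub> \<and>
          (\<forall>n. n \<^bold>\<in> omega \<longrightarrow> app \<iota> (succ n) = app \<iota> n \<oplus>\<^bsub>Q\<^esub> \<one>\<^bsub>Q\<^esub>) \<and>
          (\<forall>n. n \<^bold>\<in> omega \<and> n \<noteq> emp \<longrightarrow> app \<iota> n \<noteq> \<zero>\<^bsub>Q\<^esub>) \<and>
          (\<forall>q. q \<^bold>\<in> K \<longrightarrow> (\<exists>l m n. l \<^bold>\<in> omega \<and> m \<^bold>\<in> omega \<and> n \<^bold>\<in> omega \<and> n \<noteq> emp \<and>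
             q = (app \<iota> l \<ominus>\<^bsub>Q\<^esub> app \<iota> m) \<otimes>\<^bsub>Q\<^esub> inv\<^bsub>Q\<^esub> app \<iota> n))))"

definition is_rat_vector_space ::
  "'m \<Rightarrow> 'm \<Rightarrow> 'm \<Rightarrow> 'm \<Rightarrow> 'm \<Rightarrow> 'm \<Rightarrow> 'm \<Rightarrow> 'm \<Rightarrow> 'm \<Rightarrow> bool" where
  "is_rat_vector_space K pK tK zK eK V pV zV sV \<longleftrightarrow>
     is_rationals K pK tK zK eK \<and>
     is_fun pV (cprod V V) V \<and> is_fun sV (cprod K V) V \<and>
     module (scalars K pK tK zK eK) (vectors V pV zV sV)"

text \<open>
  \<open>is_sum V pV zV F t s\<close>: the set \<open>F\<close> is finite and \<open>s\<close> is the sum of the vectors \<open>t a\<close> for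
  \<open>a \<in> F\<close>. Here \<open>e\<close> enumerates \<open>F\<close> by the natural number \<open>n = {0, \<dots>, n - 1}\<close>, and \<open>g\<close> is the
  sequence of the \<open>n + 1\<close> partial sums. The library's \<^const>\<open>finsum\<close> cannot be used, because a
  set that is finite in the structure may have an infinite extension.
\<close>

definition is_sum :: "'m \<Rightarrow> 'm \<Rightarrow> 'm \<Rightarrow> 'm \<Rightarrow> ('m \<Rightarrow> 'm) \<Rightarrow> 'm \<Rightarrow> bool" where
  "is_sum V pV zV F t s \<longleftrightarrow>
     (\<exists>n e g. n \<^bold>\<in> omega \<and> is_bij e n F \<and> is_fun g (succ n) V \<and>
        app g emp = zV \<and>
        (\<forall>i. i \<^bold>\<in> n \<longrightarrow> app g (succ i) = app2 pV (app g i) (t (app e i))) \<and>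
        app g n = s)"

definition is_lin_comb ::
  "'m \<Rightarrow> 'm \<Rightarrow> 'm \<Rightarrow> 'm \<Rightarrow> 'm \<Rightarrow> 'm \<Rightarrow> 'm \<Rightarrow> 'm \<Rightarrow> bool" where
  "is_lin_comb K V pV zV sV F q s \<longleftrightarrow>
     is_fun q F K \<and> is_sum V pV zV F (\<lambda>a. app2 sV (app q a) a) s"

definition is_basis ::
  "'m \<Rightarrow> 'm \<Rightarrow> 'm \<Rightarrow> 'm \<Rightarrow> 'm \<Rightarrow> 'm \<Rightarrow> 'm \<Rightarrow> bool" where
  "is_basis K zK V pV zV sV B \<longleftrightarrow>
     B \<^bold>\<subseteq> V \<and>
     (\<forall>F q. F \<^bold>\<subseteq> B \<and> is_lin_comb K V pV zV sV F q zV \<longrightarrow> (\<forall>b. b \<^bold>\<in> F \<longrightarrow> app q b = zK)) \<and>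
     (\<forall>v. v \<^bold>\<in> V \<longrightarrow> (\<exists>F q. F \<^bold>\<subseteq> B \<and> is_lin_comb K V pV zV sV F q v))"

text \<open>
  \<open>FS(X)\<close>, given by its extension. It is a set of the structure by Separation.
\<close>

definition FS :: "'m \<Rightarrow> 'm \<Rightarrow> 'm \<Rightarrow> 'm \<Rightarrow> 'm set" where
  "FS V pV zV X =
     {s. \<exists>F. F \<^bold>\<subseteq> X \<and> F \<noteq> emp \<and> is_sum V pV zV F (\<lambda>a. a) s}"

definition monochromatic :: "'m \<Rightarrow> 'm set \<Rightarrow> bool" where
  "monochromatic c S \<longleftrightarrow> (\<forall>s\<in>S. \<forall>t\<in>S. app c s = app c t)"

end

end

theory Submission
  imports Defs
begin

text \<open>
  \<^bold>\<open>The mathematical argument.\<close> Fix a basis \<open>B\<close> of \<open>V\<close>, and let the weight of a vector be the number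
  of basis vectors in its support. Colour \<open>v\<close> by whether its weight lies in one of the intervals
  \<open>(4\<^sup>j, 2 \<cdot> 4\<^sup>j]\<close>; the complementary intervals are \<open>(2 \<cdot> 4\<^sup>j, 4\<^sup>j\<^sup>+\<^sup>1]\<close> (and the weights
  at most \<open>1\<close>). Let \<open>X\<close> be uncountable. Since, under Dependent Choice, an increasing
  \<open>\<omega>\<close>-union of countable sets is countable, some \<open>4\<^sup>n\<close> bounds the weight of every vector of an
  uncountable \<open>Y \<subseteq> X\<close>. If \<open>FS(X)\<close> were monochromatic, finite sums of vectors of \<open>Y\<close>, built up
  one summand at a time, could never leave the weights at most \<open>4\<^sup>n\<close> (or at most \<open>2 \<cdot> 4\<^sup>n\<close>,
  depending on the colour): a single summand of weight at most \<open>4\<^sup>n\<close> is too short to jump over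
  the next interval, and landing in it is forbidden (\<open>stage_lower_shell\<close>,
  \<open>monochromatic_imp_ctbl\<close>).

  But the finite sums of an uncountable set \<open>Y\<close> have unbounded weight
  (\<open>uncountable_sums_escape\<close>). This is proved by induction on \<open>n\<close> in the
  form: for each finite \<open>D \<subseteq> B\<close> some finite sum has more than
  \<open>n\<close> support elements outside \<open>D\<close>, and its summands are not supported in
  \<open>D\<close>. For the step choose \<open>x \<in> Y\<close> not supported in \<open>D\<close>,
  which exists because only countably many vectors are supported in \<open>D\<close>
  (\<open>ctbl_supported\<close>). Pick \<open>b\<close> in the support of \<open>x\<close> outside
  \<open>D\<close>, and apply the induction hypothesis to a finite \<open>D' \<supseteq> D\<close>
  containing the support of \<open>x\<close>. It gives a sum \<open>u\<close> with more than
  \<open>n\<close> support elements outside \<open>D'\<close>, and adding \<open>x\<close> does not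
  disturb them. At least one of \<open>u\<close> and \<open>u + x\<close> has in addition the
  support element \<open>b\<close>.

  Supports are not formed as sets. The support of \<open>v\<close> contains \<open>b\<close> exactly if \<open>v\<close> is
  outside the hyperplane spanned by \<open>B - {b}\<close>, and the vectors of weight at most \<open>n\<close> are
  the sums of \<open>n\<close> multiples of basis vectors. With these two notions, the only fact about
  counting is that a vector of weight at most \<open>n + 1\<close> with \<open>b\<close> in its support has the form
  \<open>y + a b\<close> with \<open>y\<close> of weight at most \<open>n\<close> (\<open>weight_remove\<close>).

  \<^bold>\<open>Working inside the model.\<close> The model may be ill-founded, so an induction over its natural
  numbers is legitimate only for properties expressible by a formula with parameters. The
  predicate \<open>Df\<close> isolates these properties, and the rules collected under the name \<open>df\<close>
  derive definability from the shape of a HOL term. Separation, induction and recursion are then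
  available for HOL predicates and functions that pass this test.
\<close>

section \<open>Definable predicates and terms\<close>

primrec rename :: "(nat \<Rightarrow> nat) \<Rightarrow> fm \<Rightarrow> fm" where
  "rename f (Mem i j) = Mem (f i) (f j)"
| "rename f (Eq i j) = Eq (f i) (f j)"
| "rename f (Neg p) = Neg (rename f p)"
| "rename f (And p q) = And (rename f p) (rename f q)"
| "rename f (All i p) = All (f i) (rename f p)"

text \<open>
  A renaming may merge no two variables: otherwise a quantifier could capture
  a variable that it did not bind before.
\<close>

lemma sat_rename:
  assumes "inj f"
  shows "sat E s (rename f p) \<longleftrightarrow> sat E (s \<circ> f) p"
proof (induction p arbitrary: s)
  case (All i p)
  have eq: "(s(f i := x)) \<circ> f = (s \<circ> f)(i := x)" for x
    using assms by (auto simp: fun_eq_iff inj_eq)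
  show ?case by (simp only: sat.simps rename.simps All.IH eq)
qed auto

text \<open>
  Formulas have a single assignment, but a definable predicate has arguments and parameters.
  The even variables hold the arguments \<open>s\<close>, the odd ones the parameters \<open>t\<close>, so that there is
  always room for further parameters.
\<close>

definition mix :: "(nat \<Rightarrow> 'm) \<Rightarrow> (nat \<Rightarrow> 'm) \<Rightarrow> nat \<Rightarrow> 'm" where
  "mix s t = (\<lambda>i. if even i then s (i div 2) else t (i div 2))"

lemma inj_by_parity:
  fixes f :: "nat \<Rightarrow> nat"
  assumes "\<And>i j. f (2 * i) = f (2 * j) \<Longrightarrow> i = j"
    and "\<And>i j. f (2 * i + 1) = f (2 * j + 1) \<Longrightarrow> i = j"
    and "\<And>i j. f (2 * i) \<noteq> f (2 * j + 1)"
  shows "inj f"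
proof (rule injI)
  fix x y assume eq: "f x = f y"
  consider (a) i j where "x = 2 * i" "y = 2 * j" | (b) i j where "x = 2 * i" "y = 2 * j + 1"
    | (c) i j where "x = 2 * i + 1" "y = 2 * j" | (d) i j where "x = 2 * i + 1" "y = 2 * j + 1"
    by (metis evenE oddE)
  then show "x = y"
    using assms eq by cases metis+
qed

locale membership_structure =
  fixes E :: "'m \<Rightarrow> 'm \<Rightarrow> bool"  (infix \<open>\<^bold>\<in>\<close> 50)
begin

text \<open>
  A predicate on assignments is definable if a formula with fixed parameters describes it. Bound
  variables are treated in the manner of de Bruijn: under a quantifier the new variable is
  \<open>s 0\<close>, and the older ones are shifted. A definable term is one whose graph is definable.
\<close>

definition Df :: "((nat \<Rightarrow> 'm) \<Rightarrow> bool) \<Rightarrow> bool" where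
  "Df P \<longleftrightarrow> (\<exists>p t. \<forall>s. P s \<longleftrightarrow> sat (\<^bold>\<in>) (mix s t) p)"

definition DT :: "((nat \<Rightarrow> 'm) \<Rightarrow> 'm) \<Rightarrow> bool" where
  "DT f \<longleftrightarrow> Df (\<lambda>s. s 0 = f (\<lambda>n. s (Suc n)))"

lemma DfI: "(\<And>s. P s \<longleftrightarrow> sat (\<^bold>\<in>) (mix s t) p) \<Longrightarrow> Df P"
  unfolding Df_def by blast

lemma Df_cong: "Df P \<Longrightarrow> (\<And>s. P s \<longleftrightarrow> P' s) \<Longrightarrow> Df P'"
  by (simp add: Df_def)

lemma Df_not: "Df P \<Longrightarrow> Df (\<lambda>s. \<not> P s)"
  unfolding Df_def by (metis sat.simps(3))

lemma Df_reindex: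
  assumes "Df P" "inj r"
  shows "Df (\<lambda>s. P (\<lambda>n. s (r n)))"
proof -
  obtain p t where p: "\<And>s. P s \<longleftrightarrow> sat (\<^bold>\<in>) (mix s t) p"
    using assms(1) unfolding Df_def by blast
  define f where "f = (\<lambda>i. if even i then 2 * r (i div 2) else i)"
  have f: "inj f"
    by (rule inj_by_parity) (use assms(2) in \<open>auto simp: f_def inj_eq, presburger+\<close>)
  have "mix s t \<circ> f = mix (\<lambda>n. s (r n)) t" for s
    by (auto simp: mix_def f_def fun_eq_iff)
  then show ?thesis
    by (intro DfI[where t = t and p = "rename f p"]) (simp add: sat_rename[OF f] p)
qed

text \<open>
  The two formulas may use different parameters. Both lists are kept by interleaving them in the
  odd variables, and each formula is renamed to read its own half.
\<close>

lemma Df_conj: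
  assumes "Df P" "Df Q"
  shows "Df (\<lambda>s. P s \<and> Q s)"
proof -
  obtain p t where p: "\<And>s. P s \<longleftrightarrow> sat (\<^bold>\<in>) (mix s t) p"
    using assms(1) unfolding Df_def by blast
  obtain q u where q: "\<And>s. Q s \<longleftrightarrow> sat (\<^bold>\<in>) (mix s u) q"
    using assms(2) unfolding Df_def by blast
  define f where "f = (\<lambda>i::nat. if even i then i else 2 * (2 * (i div 2)) + 1)"
  define g where "g = (\<lambda>i::nat. if even i then i else 2 * (2 * (i div 2) + 1) + 1)"
  have f: "inj f" by (rule inj_by_parity) (auto simp: f_def, presburger+)
  have g: "inj g" by (rule inj_by_parity) (auto simp: g_def, presburger+)
  have "mix s (mix t u) \<circ> f = mix s t" "mix s (mix t u) \<circ> g = mix s u" for s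
    by (auto simp: mix_def f_def g_def fun_eq_iff elim!: oddE)
  then show ?thesis
    by (intro DfI[where t = "mix t u" and p = "And (rename f p) (rename g q)"])
      (simp add: sat_rename[OF f] sat_rename[OF g] p q)
qed

text \<open>
  The quantified variable must not clash with any argument or parameter. It is given the
  variable \<open>1\<close>, vacated by shifting the parameters by one place; the variable renaming is the
  bijection that moves argument \<open>0\<close> there and every other argument down.
\<close>

lemma Df_all:
  assumes "Df (\<lambda>s. P (s 0) (\<lambda>n. s (Suc n)))"
  shows "Df (\<lambda>s. \<forall>x. P x s)"
proof -
  obtain p t where p: "\<And>s. P (s 0) (\<lambda>n. s (Suc n)) \<longleftrightarrow> sat (\<^bold>\<in>) (mix s t) p"
    using assms unfolding Df_def by blast
  define f where "f = (\<lambda>i::nat. if i = 0 then 1 else if even i then i - 2 else i + 2)"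
  have f: "inj f" by (rule inj_by_parity) (auto simp: f_def split: if_splits, presburger+)
  have "(mix s (case_nat undefined t))(1 := x) \<circ> f = mix (case_nat x s) t" for s x
  proof
    fix i :: nat
    consider "i = 0" | k where "i = 2 * Suc k" | k where "i = 2 * k + 1"
      by (metis evenE oddE not0_implies_Suc mult_0_right)
    then show "((mix s (case_nat undefined t))(1 := x) \<circ> f) i = mix (case_nat x s) t i"
      by cases (auto simp: f_def mix_def)
  qed
  then show ?thesis
    using p[of "case_nat x s" for x s]
    by (intro DfI[where t = "case_nat undefined t" and p = "All 1 (rename f p)"])
      (simp add: sat_rename[OF f])
qed

lemma Df_disj: "Df P \<Longrightarrow> Df Q \<Longrightarrow> Df (\<lambda>s. P s \<or> Q s)"
  by (rule Df_cong[OF Df_not[OF Df_conj[OF Df_not Df_not]]]) auto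

lemma Df_imp: "Df P \<Longrightarrow> Df Q \<Longrightarrow> Df (\<lambda>s. P s \<longrightarrow> Q s)"
  by (rule Df_cong[OF Df_disj[OF Df_not]]) auto

lemma Df_iff: "Df P \<Longrightarrow> Df Q \<Longrightarrow> Df (\<lambda>s. P s \<longleftrightarrow> Q s)"
  by (rule Df_cong[OF Df_conj[OF Df_imp Df_imp], of P Q Q P]) auto

lemma Df_ex:
  assumes "Df (\<lambda>s. P (s 0) (\<lambda>n. s (Suc n)))"
  shows "Df (\<lambda>s. \<exists>x. P x s)"
  by (rule Df_cong[OF Df_not[OF Df_all[of "\<lambda>x s. \<not> P x s"]]]) (use assms in \<open>auto intro: Df_not\<close>)

lemma Df_const: "Df (\<lambda>s. b)"
  by (cases b; rule DfI[where p = "if b then Eq 0 0 else Neg (Eq 0 0)"]) auto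

lemma DT_var: "DT (\<lambda>s. s i)"
  unfolding DT_def by (rule DfI[where p = "Eq 0 (2 * Suc i)"]) (simp add: mix_def)

lemma DT_const: "DT (\<lambda>s. c)"
  unfolding DT_def by (rule DfI[where p = "Eq 0 1" and t = "\<lambda>_. c"]) (simp add: mix_def)

lemma Df_weaken: "Df P \<Longrightarrow> Df (\<lambda>s. P (\<lambda>n. s (Suc n)))"
  by (rule Df_reindex[where r = Suc]) auto

lemma DT_weaken: "DT f \<Longrightarrow> DT (\<lambda>s. f (\<lambda>n. s (Suc n)))"
  unfolding DT_def
  by (drule Df_reindex[where r = "case_nat 0 (\<lambda>n. Suc (Suc n))"])
     (auto simp: inj_def split: nat.splits)

text \<open>
  Substituting a definable term is done by quantifying over its value; the composition rules
  below are instances of it. They let a notion be proved definable once, for variables, and then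
  be used with arbitrary definable terms.
\<close>

lemma Df_subst:
  assumes "Df (\<lambda>s. P (s 0) (\<lambda>n. s (Suc n)))" "DT f"
  shows "Df (\<lambda>s. P (f s) s)"
  using Df_ex[of "\<lambda>x s. x = f s \<and> P x s", OF Df_conj, OF assms(2)[unfolded DT_def] assms(1)]
  by simp

lemma Df_comp1: "Df (\<lambda>s. R (s 0)) \<Longrightarrow> DT f \<Longrightarrow> Df (\<lambda>s. R (f s))"
  by (rule Df_subst[of "\<lambda>x s. R x"])

lemma Df_comp2:
  assumes "Df (\<lambda>s. R (s 0) (s (Suc 0)))" "DT f" "DT g"
  shows "Df (\<lambda>s. R (f s) (g s))"
proof (rule Df_subst[of "\<lambda>x s. R x (g s)", OF _ assms(2)])
  have "Df (\<lambda>s. R (s (Suc 0)) (s 0))"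
    using Df_reindex[OF assms(1), of "\<lambda>n. if n = 0 then 1 else if n = 1 then 0 else n"]
    by (auto simp: inj_def)
  then show "Df (\<lambda>s. R (s 0) (g (\<lambda>n. s (Suc n))))"
    by (intro Df_subst[of "\<lambda>x s. R (s 0) x"] DT_weaken assms(3))
qed

lemma Df_comp3:
  assumes "Df (\<lambda>s. R (s 0) (s (Suc 0)) (s (Suc (Suc 0))))" "DT f" "DT g" "DT h"
  shows "Df (\<lambda>s. R (f s) (g s) (h s))"
proof (rule Df_subst[of "\<lambda>x s. R x (g s) (h s)", OF _ assms(2)])
  let ?r = "\<lambda>n::nat. if n = 0 then 2 else if n = 1 then 1 else if n = 2 then 0 else n"
  have "Df (\<lambda>s. R (s (Suc (Suc 0))) (s (Suc 0)) (s 0))"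
    using Df_reindex[OF assms(1), of ?r] by (auto simp: inj_def numeral_2_eq_2)
  then have "Df (\<lambda>s. R (s (Suc 0)) (s 0) (h (\<lambda>n. s (Suc (Suc n)))))"
    by (intro Df_subst[of "\<lambda>x s. R (s (Suc 0)) (s 0) x"] DT_weaken[of "\<lambda>s. h (\<lambda>n. s (Suc n))"]
        DT_weaken assms(4))
  then show "Df (\<lambda>s. R (s 0) (g (\<lambda>n. s (Suc n))) (h (\<lambda>n. s (Suc n))))"
    by (intro Df_subst[of "\<lambda>x s. R (s 0) x (h (\<lambda>n. s (Suc n)))"] DT_weaken assms(3))
qed

lemma DT_comp1:
  assumes "DT (\<lambda>s. h (s 0))" "DT f"
  shows "DT (\<lambda>s. h (f s))"
proof -
  have "Df (\<lambda>s. s 0 = h (f (\<lambda>n. s (Suc n))))"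
    by (rule Df_comp2[of "\<lambda>y x. y = h x"])
      (use assms in \<open>auto simp: DT_def[of "\<lambda>s. h (s 0)"] intro: DT_var DT_weaken\<close>)
  then show ?thesis unfolding DT_def .
qed

lemma DT_comp2:
  assumes "DT (\<lambda>s. h (s 0) (s (Suc 0)))" "DT f" "DT g"
  shows "DT (\<lambda>s. h (f s) (g s))"
proof -
  have "Df (\<lambda>s. s 0 = h (f (\<lambda>n. s (Suc n))) (g (\<lambda>n. s (Suc n))))"
    by (rule Df_comp3[of "\<lambda>y x z. y = h x z"])
      (use assms in \<open>auto simp: DT_def[of "\<lambda>s. h (s 0) (s (Suc 0))"] intro: DT_var DT_weaken\<close>)
  then show ?thesis unfolding DT_def .
qed

lemma Df_mem: "DT f \<Longrightarrow> DT g \<Longrightarrow> Df (\<lambda>s. f s \<^bold>\<in> g s)"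
  by (rule Df_comp2[of "\<lambda>x y. x \<^bold>\<in> y"])
     (auto intro: DfI[where p = "Mem 0 2"] simp: mix_def)

lemma Df_eq: "DT f \<Longrightarrow> DT g \<Longrightarrow> Df (\<lambda>s. f s = g s)"
  by (rule Df_comp2[of "\<lambda>x y. x = y"])
     (auto intro: DfI[where p = "Eq 0 2"] simp: mix_def)

lemma DT_graph: "Df (\<lambda>s. P (s 0) (\<lambda>n. s (Suc n))) \<Longrightarrow> (\<And>s y. P y s \<longleftrightarrow> y = f s) \<Longrightarrow> DT f"
  unfolding DT_def by (erule Df_cong) simp

lemma DT_if: 
  assumes "Df P" "DT f" "DT g" shows "DT (\<lambda>s. if P s then f s else g s)"
  by (rule DT_graph[of "\<lambda>y s. (P s \<and> y = f s) \<or> (\<not> P s \<and> y = g s)"])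
     (use assms in \<open>auto intro!: Df_disj Df_conj Df_not Df_weaken Df_eq DT_var DT_weaken\<close>)

lemmas df_basic = Df_not Df_conj Df_all Df_disj Df_imp Df_iff Df_ex Df_const DT_var DT_const
  Df_mem Df_eq DT_if

end

section \<open>Elementary set theory in the model\<close>

named_theorems df

locale zf_model = membership_structure E for E :: "'m \<Rightarrow> 'm \<Rightarrow> bool"  (infix \<open>\<^bold>\<in>\<close> 50) +
  assumes ZF: "ZF (\<^bold>\<in>)"
begin

lemmas [df] = df_basic

abbreviation subset_m  (infix \<open>\<^bold>\<subseteq>\<close> 50) where "a \<^bold>\<subseteq> b \<equiv> is_subset (\<^bold>\<in>) a b"
abbreviation pair_m  (\<open>\<langle>_, _\<rangle>\<close>) where "\<langle>a, b\<rangle> \<equiv> opair (\<^bold>\<in>) a b"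
abbreviation empty_m  (\<open>\<^bold>0\<close>) where "\<^bold>0 \<equiv> emp (\<^bold>\<in>)"
abbreviation succ_m where "succ_m \<equiv> succ (\<^bold>\<in>)"
abbreviation omega_m  (\<open>\<omega>\<close>) where "\<omega> \<equiv> omega (\<^bold>\<in>)"
abbreviation fun_m where "fun_m \<equiv> is_fun (\<^bold>\<in>)"
abbreviation app_m where "app_m \<equiv> app (\<^bold>\<in>)"

lemma ext_m: "(\<And>x. x \<^bold>\<in> a \<longleftrightarrow> x \<^bold>\<in> b) \<Longrightarrow> a = b"
  using ZF unfolding ZF_def extensionality_def by blast

lemma the_set:
  assumes "\<exists>b. \<forall>x. x \<^bold>\<in> b \<longleftrightarrow> P x"
  shows "x \<^bold>\<in> (THE b. \<forall>x. x \<^bold>\<in> b \<longleftrightarrow> P x) \<longleftrightarrow> P x"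
proof -
  have "\<exists>!b. \<forall>x. x \<^bold>\<in> b \<longleftrightarrow> P x"
    using assms ext_m by metis
  from theI'[OF this] show ?thesis by blast
qed

text \<open>
  Only \<open>s 0\<close> is inspected by the predicate, so all other argument variables may
  be filled with any object, here \<open>a\<close>.
\<close>

lemma separation_Df:
  assumes "Df (\<lambda>s. P (s 0))"
  shows "\<exists>b. \<forall>x. x \<^bold>\<in> b \<longleftrightarrow> x \<^bold>\<in> a \<and> P x"
proof -
  obtain p t where p: "\<And>s. P (s 0) \<longleftrightarrow> sat (\<^bold>\<in>) (mix s t) p"
    using assms unfolding Df_def by blast
  have eq: "(mix s t)(0 := x) = mix (s(0 := x)) t" for s x
    by (auto simp: mix_def fun_eq_iff elim!: evenE)
  have "\<exists>b. \<forall>x. x \<^bold>\<in> b \<longleftrightarrow> x \<^bold>\<in> a \<and> sat (\<^bold>\<in>) ((mix (\<lambda>_. a) t)(0 := x)) p"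
    using ZF unfolding ZF_def separation_def by blast
  then show ?thesis unfolding eq p[symmetric] by simp
qed

definition coll :: "'m \<Rightarrow> ('m \<Rightarrow> bool) \<Rightarrow> 'm" where
  "coll a P = (THE b. \<forall>x. x \<^bold>\<in> b \<longleftrightarrow> x \<^bold>\<in> a \<and> P x)"

lemma mem_coll: "Df (\<lambda>s. P (s 0)) \<Longrightarrow> x \<^bold>\<in> coll a P \<longleftrightarrow> x \<^bold>\<in> a \<and> P x"
  unfolding coll_def by (rule the_set[OF separation_Df])

lemma Df_instance:
  assumes "Df (\<lambda>s. P (s 0) (s (Suc 0)))"
  shows "Df (\<lambda>s. P (s 0) c)"
  by (rule Df_comp2[of P, OF assms]) (intro df)+

text \<open>
  A set given by separation depends definably on a parameter of the separating predicate. This is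
  what allows such operations as steps of recursions.
\<close>

lemma DT_coll:
  assumes "Df (\<lambda>s. P (s 0) (s (Suc 0)))"
  shows "DT (\<lambda>s. coll a (\<lambda>x. P x (s 0)))"
proof (rule DT_graph[of "\<lambda>y s. \<forall>x. x \<^bold>\<in> y \<longleftrightarrow> x \<^bold>\<in> a \<and> P x (s 0)"])
  show "Df (\<lambda>s. \<forall>x. x \<^bold>\<in> s 0 \<longleftrightarrow> x \<^bold>\<in> a \<and> P x (s (Suc 0)))"
    by (intro df Df_comp2[of P, OF assms])
  show "(\<forall>x. x \<^bold>\<in> y \<longleftrightarrow> x \<^bold>\<in> a \<and> P x (s 0)) \<longleftrightarrow> y = coll a (\<lambda>x. P x (s 0))" for s y
    using mem_coll[OF Df_instance, OF assms] ext_m by auto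
qed

lemma mem_emp [simp]: "\<not> x \<^bold>\<in> \<^bold>0"
proof -
  have "\<exists>z. \<forall>x. \<not> x \<^bold>\<in> z"
    using ZF unfolding ZF_def infinity_def by blast
  then show ?thesis unfolding emp_def using the_set[of "\<lambda>_. False"] by simp
qed

lemma mem_upair [simp]: "x \<^bold>\<in> upair (\<^bold>\<in>) a b \<longleftrightarrow> x = a \<or> x = b"
  unfolding upair_def by (rule the_set) (use ZF in \<open>auto simp: ZF_def pairing_def\<close>)

lemma upair_eq_iff: "upair (\<^bold>\<in>) a b = upair (\<^bold>\<in>) c d \<longleftrightarrow> (a = c \<and> b = d) \<or> (a = d \<and> b = c)"
proof
  assume eq: "upair (\<^bold>\<in>) a b = upair (\<^bold>\<in>) c d"
  have "x = a \<or> x = b \<longleftrightarrow> x = c \<or> x = d" for x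
    using mem_upair[of x a b] mem_upair[of x c d] unfolding eq by blast
  then show "(a = c \<and> b = d) \<or> (a = d \<and> b = c)" by metis
qed (auto intro: ext_m)

lemma opair_eq_iff [simp]: "\<langle>a, b\<rangle> = \<langle>c, d\<rangle> \<longleftrightarrow> a = c \<and> b = d"
  unfolding opair_def upair_eq_iff by auto

lemma DT_upair0: "DT (\<lambda>s. upair (\<^bold>\<in>) (s 0) (s (Suc 0)))"
  by (rule DT_graph[of "\<lambda>y s. \<forall>x. x \<^bold>\<in> y \<longleftrightarrow> x = s 0 \<or> x = s (Suc 0)"])
     ((intro df), (auto intro: ext_m))

lemmas DT_upair [df] = DT_comp2[OF DT_upair0]

lemma DT_opair [df]: "DT f \<Longrightarrow> DT g \<Longrightarrow> DT (\<lambda>s. \<langle>f s, g s\<rangle>)"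
  unfolding opair_def by (intro df)

lemma Df_subset [df]: "DT f \<Longrightarrow> DT g \<Longrightarrow> Df (\<lambda>s. f s \<^bold>\<subseteq> g s)"
  by (rule Df_comp2[of "\<lambda>x y. x \<^bold>\<subseteq> y"]) (unfold is_subset_def, intro df)

lemma union_ex: "\<exists>u. \<forall>x. x \<^bold>\<in> u \<longleftrightarrow> x \<^bold>\<in> a \<or> x \<^bold>\<in> b"
proof -
  have "\<exists>u. \<forall>x. x \<^bold>\<in> u \<longleftrightarrow> (\<exists>y. x \<^bold>\<in> y \<and> y \<^bold>\<in> upair (\<^bold>\<in>) a b)"
    using ZF unfolding ZF_def union_def by blast
  then show ?thesis by auto
qed

definition ins :: "'m \<Rightarrow> 'm \<Rightarrow> 'm" where
  "ins A b = (THE z. \<forall>x. x \<^bold>\<in> z \<longleftrightarrow> x \<^bold>\<in> A \<or> x = b)"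

lemma mem_ins [simp]: "x \<^bold>\<in> ins A b \<longleftrightarrow> x \<^bold>\<in> A \<or> x = b"
proof -
  have "\<exists>z. \<forall>x. x \<^bold>\<in> z \<longleftrightarrow> x \<^bold>\<in> A \<or> x = b"
    using union_ex[of A "upair (\<^bold>\<in>) b b"] by auto
  then show ?thesis unfolding ins_def by (rule the_set)
qed

lemma succ_eq_ins: "succ_m n = ins n n"
  by (simp add: succ_def ins_def)

lemma mem_succ [simp]: "x \<^bold>\<in> succ_m n \<longleftrightarrow> x \<^bold>\<in> n \<or> x = n"
  by (simp add: succ_eq_ins)

lemma DT_ins0: "DT (\<lambda>s. ins (s 0) (s (Suc 0)))"
  by (rule DT_graph[of "\<lambda>y s. \<forall>x. x \<^bold>\<in> y \<longleftrightarrow> x \<^bold>\<in> s 0 \<or> x = s (Suc 0)"])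
     ((intro df), (auto intro: ext_m))

lemmas DT_ins [df] = DT_comp2[OF DT_ins0]

lemma DT_succ [df]: "DT f \<Longrightarrow> DT (\<lambda>s. succ_m (f s))"
  unfolding succ_eq_ins by (intro df)

definition Pow_m :: "'m \<Rightarrow> 'm" where
  "Pow_m a = (THE p. \<forall>x. x \<^bold>\<in> p \<longleftrightarrow> x \<^bold>\<subseteq> a)"

lemma mem_Pow [simp]: "x \<^bold>\<in> Pow_m a \<longleftrightarrow> x \<^bold>\<subseteq> a"
  unfolding Pow_m_def by (rule the_set) (use ZF in \<open>auto simp: ZF_def power_set_def\<close>)

lemma mem_cprod [simp]: "z \<^bold>\<in> cprod (\<^bold>\<in>) A B \<longleftrightarrow> (\<exists>a b. a \<^bold>\<in> A \<and> b \<^bold>\<in> B \<and> z = \<langle>a, b\<rangle>)"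
proof -
  obtain U where U: "\<And>x. x \<^bold>\<in> U \<longleftrightarrow> x \<^bold>\<in> A \<or> x \<^bold>\<in> B" using union_ex[of A B] by auto
  let ?P = "\<lambda>z. \<exists>a b. a \<^bold>\<in> A \<and> b \<^bold>\<in> B \<and> z = \<langle>a, b\<rangle>"
  have "Df (\<lambda>s. ?P (s 0))" by (intro df)
  from mem_coll[OF this, of _ "Pow_m (Pow_m U)"]
  have "\<forall>z. z \<^bold>\<in> coll (Pow_m (Pow_m U)) ?P \<longleftrightarrow> ?P z"
    using U by (auto simp: opair_def is_subset_def)
  then show ?thesis unfolding cprod_def by (intro the_set) blast
qed

lemma pair_mem_cprod: "\<langle>a, b\<rangle> \<^bold>\<in> cprod (\<^bold>\<in>) A B \<longleftrightarrow> a \<^bold>\<in> A \<and> b \<^bold>\<in> B"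
  by auto

text \<open>
  Application, with the value \<open>\<^bold>0\<close> where it makes no sense. Unlike a bare definite description
  it is a definable term, and it agrees with \<open>app\<close> on the domain of a function.
\<close>

definition ap :: "'m \<Rightarrow> 'm \<Rightarrow> 'm" where
  "ap f x = (if \<exists>!y. \<langle>x, y\<rangle> \<^bold>\<in> f then THE y. \<langle>x, y\<rangle> \<^bold>\<in> f else \<^bold>0)"

lemma DT_ap0: "DT (\<lambda>s. ap (s 0) (s (Suc 0)))"
proof (rule DT_graph[of "\<lambda>y s. if \<exists>z. \<langle>s (Suc 0), z\<rangle> \<^bold>\<in> s 0 \<and> (\<forall>z'. \<langle>s (Suc 0), z'\<rangle> \<^bold>\<in> s 0 \<longrightarrow> z' = z)
    then \<langle>s (Suc 0), y\<rangle> \<^bold>\<in> s 0 else y = \<^bold>0"])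
  show "Df (\<lambda>s. if \<exists>z. \<langle>s (Suc (Suc 0)), z\<rangle> \<^bold>\<in> s (Suc 0) \<and> (\<forall>z'. \<langle>s (Suc (Suc 0)), z'\<rangle> \<^bold>\<in> s (Suc 0) \<longrightarrow> z' = z)
    then \<langle>s (Suc (Suc 0)), s 0\<rangle> \<^bold>\<in> s (Suc 0) else s 0 = \<^bold>0)"
    unfolding if_bool_eq_conj by (intro df)
  show "(if \<exists>z. \<langle>s (Suc 0), z\<rangle> \<^bold>\<in> s 0 \<and> (\<forall>z'. \<langle>s (Suc 0), z'\<rangle> \<^bold>\<in> s 0 \<longrightarrow> z' = z)
    then \<langle>s (Suc 0), y\<rangle> \<^bold>\<in> s 0 else y = \<^bold>0) \<longleftrightarrow> y = ap (s 0) (s (Suc 0))" for s y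
  proof (cases "\<exists>!y. \<langle>s (Suc 0), y\<rangle> \<^bold>\<in> s 0")
    case True
    then show ?thesis using theI'[OF True] unfolding ap_def by auto
  qed (auto simp: ap_def)
qed

lemmas DT_ap [df] = DT_comp2[OF DT_ap0]

lemma fun_app:
  assumes "fun_m f A B" "x \<^bold>\<in> A"
  shows "\<langle>x, y\<rangle> \<^bold>\<in> f \<longleftrightarrow> y = ap f x" "app_m f x = ap f x" "ap f x \<^bold>\<in> B"
proof -
  have ex: "\<exists>!y. \<langle>x, y\<rangle> \<^bold>\<in> f" using assms unfolding is_fun_def by blast
  then show "app_m f x = ap f x" by (simp add: app_def ap_def)
  show *: "\<langle>x, y\<rangle> \<^bold>\<in> f \<longleftrightarrow> y = ap f x" for y using theI'[OF ex] ex by (auto simp: ap_def)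
  have "\<langle>x, ap f x\<rangle> \<^bold>\<in> f" using * by blast
  then show "ap f x \<^bold>\<in> B" using assms unfolding is_fun_def is_subset_def by fastforce
qed

lemma Df_fun0: "Df (\<lambda>s. fun_m (s 0) (s (Suc 0)) (s (Suc (Suc 0))))"
  unfolding is_fun_def is_subset_def mem_cprod Ex1_def by (intro df)

lemmas Df_fun [df] = Df_comp3[OF Df_fun0]

lemma fun_exists_rel:
  assumes "Df (\<lambda>s. P (s 0) (s (Suc 0)))"
    and "\<And>x. x \<^bold>\<in> A \<Longrightarrow> \<exists>!y. y \<^bold>\<in> B \<and> P x y"
  shows "\<exists>f. fun_m f A B \<and> (\<forall>x. x \<^bold>\<in> A \<longrightarrow> P x (ap f x))"
proof -
  let ?Q = "\<lambda>z. \<exists>x y. z = \<langle>x, y\<rangle> \<and> P x y"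
  have "Df (\<lambda>s. ?Q (s 0))" by (intro df Df_comp2[of P, OF assms(1)])
  note m = mem_coll[OF this, of _ "cprod (\<^bold>\<in>) A B"]
  let ?f = "coll (cprod (\<^bold>\<in>) A B) ?Q"
  have f: "fun_m ?f A B"
    unfolding is_fun_def is_subset_def m using assms(2) by (auto simp: Ex1_def)
  have "P x (ap ?f x)" if "x \<^bold>\<in> A" for x
    using fun_app(1)[OF f that, of "ap ?f x"] unfolding m by auto
  then show ?thesis using f by blast
qed

lemma fun_exists:
  assumes "DT (\<lambda>s. h (s 0))" and "\<And>x. x \<^bold>\<in> A \<Longrightarrow> h x \<^bold>\<in> B"
  shows "\<exists>f. fun_m f A B \<and> (\<forall>x. x \<^bold>\<in> A \<longrightarrow> ap f x = h x)"
  using fun_exists_rel[of "\<lambda>x y. y = h x" A B]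
    Df_eq[OF DT_var DT_comp1[OF assms(1) DT_var], of "Suc 0" 0] assms(2) by auto

lemma fun_existsE:
  assumes "DT (\<lambda>s. h (s 0))" "\<And>x. x \<^bold>\<in> X \<Longrightarrow> h x \<^bold>\<in> Y"
  obtains f where "fun_m f X Y" "\<And>x. x \<^bold>\<in> X \<Longrightarrow> ap f x = h x"
  using fun_exists[of h X Y] assms by blast

lemma mem_asym: "x \<^bold>\<in> y \<Longrightarrow> \<not> y \<^bold>\<in> x"
proof
  assume "x \<^bold>\<in> y" "y \<^bold>\<in> x"
  have "(\<exists>z. z \<^bold>\<in> upair (\<^bold>\<in>) x y) \<longrightarrow>
     (\<exists>z. z \<^bold>\<in> upair (\<^bold>\<in>) x y \<and> \<not> (\<exists>w. w \<^bold>\<in> z \<and> w \<^bold>\<in> upair (\<^bold>\<in>) x y))"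
    using ZF unfolding ZF_def foundation_def by blast
  then show False using \<open>x \<^bold>\<in> y\<close> \<open>y \<^bold>\<in> x\<close> by auto
qed

lemma mem_irrefl [simp]: "\<not> x \<^bold>\<in> x"
  using mem_asym by blast

lemma succ_inject [simp]: "succ_m m = succ_m n \<longleftrightarrow> m = n"
  using mem_succ mem_asym by metis

lemma succ_ne_emp [simp]: "succ_m n \<noteq> \<^bold>0"
  by (metis mem_emp mem_succ)

lemma emp_ne_succ [simp]: "\<^bold>0 \<noteq> succ_m n"
  by (metis succ_ne_emp)

text \<open>
  Foundation, in the form of minimal elements for definable predicates; it gives least
  natural numbers below.
\<close>

lemma minimal_element:
  assumes "Df (\<lambda>s. P (s 0))" "a \<^bold>\<in> A" "P a"
  shows "\<exists>x. x \<^bold>\<in> A \<and> P x \<and> (\<forall>y. y \<^bold>\<in> x \<and> y \<^bold>\<in> A \<longrightarrow> \<not> P y)"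
proof -
  have "\<exists>x. x \<^bold>\<in> coll A P \<and> \<not> (\<exists>y. y \<^bold>\<in> x \<and> y \<^bold>\<in> coll A P)"
    using ZF assms(2,3) mem_coll[OF assms(1), of a A] unfolding ZF_def foundation_def by metis
  then show ?thesis unfolding mem_coll[OF assms(1)] by blast
qed

section \<open>Natural numbers of the model\<close>

lemma omega_least: "is_inductive (\<^bold>\<in>) \<omega> \<and> (\<forall>w'. is_inductive (\<^bold>\<in>) w' \<longrightarrow> \<omega> \<^bold>\<subseteq> w')"
proof -
  obtain w where w: "\<exists>z. z \<^bold>\<in> w \<and> (\<forall>x. \<not> x \<^bold>\<in> z)"
    "\<forall>n. n \<^bold>\<in> w \<longrightarrow> (\<exists>m. m \<^bold>\<in> w \<and> (\<forall>x. x \<^bold>\<in> m \<longleftrightarrow> x \<^bold>\<in> n \<or> x = n))"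
    using ZF unfolding ZF_def infinity_def by blast
  have "is_inductive (\<^bold>\<in>) w"
    unfolding is_inductive_def using w ext_m mem_emp mem_succ by metis
  let ?P = "\<lambda>n. \<forall>w'. \<^bold>0 \<^bold>\<in> w' \<and> (\<forall>n. n \<^bold>\<in> w' \<longrightarrow> succ_m n \<^bold>\<in> w') \<longrightarrow> n \<^bold>\<in> w'"
  have "Df (\<lambda>s. ?P (s 0))" by (intro df)
  note m = mem_coll[OF this, of _ w]
  let ?o = "coll w ?P"
  have "is_inductive (\<^bold>\<in>) ?o \<and> (\<forall>w'. is_inductive (\<^bold>\<in>) w' \<longrightarrow> ?o \<^bold>\<subseteq> w')"
    using \<open>is_inductive (\<^bold>\<in>) w\<close> unfolding is_inductive_def m is_subset_def by blast
  then have "\<exists>!w. is_inductive (\<^bold>\<in>) w \<and> (\<forall>w'. is_inductive (\<^bold>\<in>) w' \<longrightarrow> w \<^bold>\<subseteq> w')"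
    by (intro ex1I[of _ ?o]) (auto simp: is_subset_def intro!: ext_m)
  from theI'[OF this] show ?thesis unfolding omega_def .
qed

lemma zero_in_omega [simp]: "\<^bold>0 \<^bold>\<in> \<omega>" and succ_in_omega [simp]: "n \<^bold>\<in> \<omega> \<Longrightarrow> succ_m n \<^bold>\<in> \<omega>"
  using omega_least unfolding is_inductive_def by blast+

text \<open>
  Definability of \<open>P\<close> is essential: the model may have nonstandard natural numbers, and then
  being standard is preserved by successors and yet does not hold on all of \<open>\<omega>\<close>.
\<close>

lemma omega_induct [consumes 1, case_names Df zero succ]:
  assumes "n \<^bold>\<in> \<omega>" "Df (\<lambda>s. P (s 0))" "P \<^bold>0" "\<And>n. n \<^bold>\<in> \<omega> \<Longrightarrow> P n \<Longrightarrow> P (succ_m n)"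
  shows "P n"
proof -
  have "is_inductive (\<^bold>\<in>) (coll \<omega> P)"
    unfolding is_inductive_def mem_coll[OF assms(2)] using assms(3,4) by simp
  then have "\<omega> \<^bold>\<subseteq> coll \<omega> P" using omega_least by blast
  then show ?thesis using assms(1) by (simp add: is_subset_def mem_coll[OF assms(2)])
qed

lemma omega_trans: "n \<^bold>\<in> \<omega> \<Longrightarrow> m \<^bold>\<in> n \<Longrightarrow> m \<^bold>\<in> \<omega>"
proof -
  assume "n \<^bold>\<in> \<omega>"
  then have "\<forall>m. m \<^bold>\<in> n \<longrightarrow> m \<^bold>\<in> \<omega>"
    by (induction rule: omega_induct) (intro df, auto)
  then show "m \<^bold>\<in> n \<Longrightarrow> m \<^bold>\<in> \<omega>" by blast
qed

lemma mem_trans: "n \<^bold>\<in> \<omega> \<Longrightarrow> m \<^bold>\<in> n \<Longrightarrow> k \<^bold>\<in> m \<Longrightarrow> k \<^bold>\<in> n"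
proof -
  assume "n \<^bold>\<in> \<omega>"
  then have "\<forall>m k. m \<^bold>\<in> n \<and> k \<^bold>\<in> m \<longrightarrow> k \<^bold>\<in> n"
    by (induction rule: omega_induct) (intro df, auto)
  then show "m \<^bold>\<in> n \<Longrightarrow> k \<^bold>\<in> m \<Longrightarrow> k \<^bold>\<in> n" by blast
qed

lemma zero_mem_succ: "n \<^bold>\<in> \<omega> \<Longrightarrow> \<^bold>0 \<^bold>\<in> succ_m n"
  by (induction rule: omega_induct) (intro df, auto)

lemma succ_mem_succ: "n \<^bold>\<in> \<omega> \<Longrightarrow> m \<^bold>\<in> n \<Longrightarrow> succ_m m \<^bold>\<in> succ_m n"
proof -
  assume "n \<^bold>\<in> \<omega>"
  then have "\<forall>m. m \<^bold>\<in> n \<longrightarrow> succ_m m \<^bold>\<in> succ_m n"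
    by (induction rule: omega_induct) (intro df, auto)
  then show "m \<^bold>\<in> n \<Longrightarrow> succ_m m \<^bold>\<in> succ_m n" by blast
qed

lemma omega_linear:
  assumes "m \<^bold>\<in> \<omega>" "n \<^bold>\<in> \<omega>"
  shows "m \<^bold>\<in> n \<or> m = n \<or> n \<^bold>\<in> m"
  using assms(1)
proof (induction rule: omega_induct)
  case Df
  show ?case by (intro df)
next
  case zero
  then show ?case using zero_mem_succ[OF assms(2)] by auto
next
  case (succ m)
  then show ?case using succ_mem_succ[OF assms(2), of m] by auto
qed

lemma omega_cases: "n \<^bold>\<in> \<omega> \<Longrightarrow> n = \<^bold>0 \<or> (\<exists>m. m \<^bold>\<in> \<omega> \<and> n = succ_m m)"
  by (induction rule: omega_induct) (intro df, auto)

section \<open>Recursion\<close>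

text \<open>
  The graph of the function defined by recursion from \<open>a\<close> with step \<open>G\<close> is the least relation
  closed under the recursion clauses. Describing it as an intersection avoids finite
  approximations.
\<close>

definition in_rec :: "'m \<Rightarrow> ('m \<Rightarrow> 'm) \<Rightarrow> 'm \<Rightarrow> 'm \<Rightarrow> 'm \<Rightarrow> bool" where
  "in_rec A G a n y \<longleftrightarrow> (\<forall>R. \<langle>\<^bold>0, a\<rangle> \<^bold>\<in> R \<and>
     (\<forall>k z. k \<^bold>\<in> \<omega> \<and> z \<^bold>\<in> A \<and> \<langle>k, z\<rangle> \<^bold>\<in> R \<longrightarrow> \<langle>succ_m k, G z\<rangle> \<^bold>\<in> R) \<longrightarrow> \<langle>n, y\<rangle> \<^bold>\<in> R)"

definition recur :: "'m \<Rightarrow> ('m \<Rightarrow> 'm) \<Rightarrow> 'm \<Rightarrow> 'm \<Rightarrow> 'm" where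
  "recur A G a n = (if n \<^bold>\<in> \<omega> \<and> a \<^bold>\<in> A then THE y. in_rec A G a n y else \<^bold>0)"

context
  fixes A G
  assumes DT_G: "DT (\<lambda>s. G (s 0))" and G_closed: "\<And>z. z \<^bold>\<in> A \<Longrightarrow> G z \<^bold>\<in> A"
begin

lemma Df_in_rec: "DT f \<Longrightarrow> DT g \<Longrightarrow> DT h \<Longrightarrow> Df (\<lambda>s. in_rec A G (f s) (g s) (h s))"
  by (rule Df_comp3[of "in_rec A G"]) (unfold in_rec_def, intro df DT_comp1[OF DT_G])

lemma in_rec_zero: "in_rec A G a \<^bold>0 a"
  unfolding in_rec_def by blast

lemma in_rec_succ: "k \<^bold>\<in> \<omega> \<Longrightarrow> z \<^bold>\<in> A \<Longrightarrow> in_rec A G a k z \<Longrightarrow> in_rec A G a (succ_m k) (G z)"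
  unfolding in_rec_def by blast

lemma in_rec_induct:
  assumes "in_rec A G a n y" "a \<^bold>\<in> A" "Df (\<lambda>s. Q (s 0) (s (Suc 0)))" "Q \<^bold>0 a"
    and "\<And>k z. k \<^bold>\<in> \<omega> \<Longrightarrow> z \<^bold>\<in> A \<Longrightarrow> in_rec A G a k z \<Longrightarrow> Q k z \<Longrightarrow> Q (succ_m k) (G z)"
  shows "y \<^bold>\<in> A \<and> Q n y"
proof -
  let ?Q = "\<lambda>p. \<exists>k z. p = \<langle>k, z\<rangle> \<and> in_rec A G a k z \<and> Q k z"
  have "Df (\<lambda>s. ?Q (s 0))" by (intro df Df_in_rec Df_comp2[of Q, OF assms(3)])
  note m = mem_coll[OF this, of _ "cprod (\<^bold>\<in>) \<omega> A"]
  have "\<langle>n, y\<rangle> \<^bold>\<in> coll (cprod (\<^bold>\<in>) \<omega> A) ?Q"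
    by (rule assms(1)[unfolded in_rec_def, rule_format])
      (auto simp: m assms(2,4) G_closed in_rec_zero intro: in_rec_succ assms(5))
  then show ?thesis by (auto simp: m)
qed

text \<open>
  A second value at a point would be superfluous in the least closed relation: the relation
  without it would still be closed.
\<close>

lemma in_rec_unique:
  assumes "n \<^bold>\<in> \<omega>" "a \<^bold>\<in> A"
  shows "\<exists>y. y \<^bold>\<in> A \<and> in_rec A G a n y \<and> (\<forall>y'. in_rec A G a n y' \<longrightarrow> y' = y)"
  using assms(1)
proof (induction rule: omega_induct)
  case Df
  show ?case by (intro df Df_in_rec)
next
  case zero
  have "Df (\<lambda>s. s 0 = \<^bold>0 \<longrightarrow> s (Suc 0) = a)" by (intro df)
  then have "y = a" if "in_rec A G a \<^bold>0 y" for y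
    using in_rec_induct[OF that assms(2), of "\<lambda>k z. k = \<^bold>0 \<longrightarrow> z = a"] by auto
  then show ?case using in_rec_zero assms(2) by blast
next
  case (succ n)
  then obtain y where y: "y \<^bold>\<in> A" "in_rec A G a n y" "\<And>y'. in_rec A G a n y' \<Longrightarrow> y' = y" by blast
  have "y' = G y" if y': "in_rec A G a (succ_m n) y'" for y'
  proof -
    have "y' \<^bold>\<in> A \<and> (succ_m n = succ_m n \<longrightarrow> y' = G y)"
    proof (rule in_rec_induct[OF y' assms(2), of "\<lambda>k z. k = succ_m n \<longrightarrow> z = G y"])
      show "Df (\<lambda>s. s 0 = succ_m n \<longrightarrow> s (Suc 0) = G y)" by (intro df)
      show "\<^bold>0 = succ_m n \<longrightarrow> a = G y" using succ_ne_emp[of n] by metis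
      show "succ_m k = succ_m n \<longrightarrow> G z = G y" if "in_rec A G a k z" for k z
        using that y(3)[of z] by auto
    qed
    then show ?thesis by simp
  qed
  then show ?case using in_rec_succ[OF succ(1) y(1,2)] G_closed[OF y(1)] by blast
qed

lemma recur_iff:
  assumes "n \<^bold>\<in> \<omega>" "a \<^bold>\<in> A"
  shows "in_rec A G a n y \<longleftrightarrow> y = recur A G a n" and recur_closed: "recur A G a n \<^bold>\<in> A"
proof -
  obtain z where z: "z \<^bold>\<in> A" "in_rec A G a n z" "\<And>y'. in_rec A G a n y' \<Longrightarrow> y' = z"
    using in_rec_unique[OF assms] by blast
  have "(THE y. in_rec A G a n y) = z" using z(2,3) by (rule the_equality)
  then have "recur A G a n = z" by (simp add: recur_def assms)
  then show "in_rec A G a n y \<longleftrightarrow> y = recur A G a n" "recur A G a n \<^bold>\<in> A" using z by blast+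
qed

lemma recur_zero: "a \<^bold>\<in> A \<Longrightarrow> recur A G a \<^bold>0 = a"
  using recur_iff(1)[OF zero_in_omega, of a a] in_rec_zero by (blast dest: sym)

lemma recur_succ: "n \<^bold>\<in> \<omega> \<Longrightarrow> a \<^bold>\<in> A \<Longrightarrow> recur A G a (succ_m n) = G (recur A G a n)"
  using recur_iff(1)[of "succ_m n" a "G (recur A G a n)"] in_rec_succ[of n "recur A G a n" a]
    recur_iff(1)[of n a "recur A G a n"] recur_closed[of n a] succ_in_omega[of n]
  by (blast dest: sym)

lemma DT_recur0: "DT (\<lambda>s. recur A G (s 0) (s (Suc 0)))"
proof (rule DT_graph[of "\<lambda>y s. (s (Suc 0) \<^bold>\<in> \<omega> \<and> s 0 \<^bold>\<in> A \<and> in_rec A G (s 0) (s (Suc 0)) y)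
    \<or> (\<not> (s (Suc 0) \<^bold>\<in> \<omega> \<and> s 0 \<^bold>\<in> A) \<and> y = \<^bold>0)"])
  show "((s (Suc 0) \<^bold>\<in> \<omega> \<and> s 0 \<^bold>\<in> A \<and> in_rec A G (s 0) (s (Suc 0)) y)
    \<or> (\<not> (s (Suc 0) \<^bold>\<in> \<omega> \<and> s 0 \<^bold>\<in> A) \<and> y = \<^bold>0)) \<longleftrightarrow> y = recur A G (s 0) (s (Suc 0))" for s y
  proof (cases "s (Suc 0) \<^bold>\<in> \<omega> \<and> s 0 \<^bold>\<in> A")
    case True
    then show ?thesis using recur_iff(1) by blast
  qed (auto simp: recur_def)
qed (intro df Df_in_rec)

lemmas DT_recur = DT_comp2[OF DT_recur0]

end

section \<open>A pairing function on the natural numbers\<close>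

definition dbl :: "'m \<Rightarrow> 'm" where
  "dbl n = recur \<omega> (\<lambda>x. succ_m (succ_m x)) \<^bold>0 n"

lemma dbl_rec: "DT (\<lambda>s. succ_m (succ_m (s 0)))" by (intro df)

lemma DT_dbl [df]: "DT f \<Longrightarrow> DT (\<lambda>s. dbl (f s))"
  unfolding dbl_def by (intro DT_recur dbl_rec df) auto

lemma dbl_zero [simp]: "dbl \<^bold>0 = \<^bold>0"
  unfolding dbl_def by (rule recur_zero[OF dbl_rec]) auto

lemma dbl_succ [simp]: "n \<^bold>\<in> \<omega> \<Longrightarrow> dbl (succ_m n) = succ_m (succ_m (dbl n))"
  unfolding dbl_def by (rule recur_succ[OF dbl_rec]) auto

lemma dbl_in_omega [simp]: "n \<^bold>\<in> \<omega> \<Longrightarrow> dbl n \<^bold>\<in> \<omega>"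
  unfolding dbl_def by (rule recur_closed[OF dbl_rec]) auto

lemma dbl_inject:
  assumes "m \<^bold>\<in> \<omega>"
  shows "\<forall>n. n \<^bold>\<in> \<omega> \<and> dbl m = dbl n \<longrightarrow> m = n"
  using assms
proof (induction rule: omega_induct)
  case Df
  show ?case by (intro df)
next
  case zero
  then show ?case using omega_cases succ_ne_emp by (metis dbl_succ dbl_zero)
next
  case (succ m)
  then show ?case using omega_cases succ_ne_emp succ_inject by (metis dbl_succ dbl_zero)
qed

lemma dbl_ne_succ_dbl:
  assumes "m \<^bold>\<in> \<omega>"
  shows "\<forall>n. n \<^bold>\<in> \<omega> \<longrightarrow> dbl m \<noteq> succ_m (dbl n)"
  using assms
proof (induction rule: omega_induct)
  case Df
  show ?case by (intro df)
next
  case zero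
  then show ?case by simp
next
  case (succ m)
  show ?case
  proof (intro allI impI)
    fix n assume "n \<^bold>\<in> \<omega>"
    then consider "n = \<^bold>0" | k where "k \<^bold>\<in> \<omega>" "n = succ_m k" using omega_cases by blast
    then show "dbl (succ_m m) \<noteq> succ_m (dbl n)"
      by cases (use succ in \<open>auto dest: sym\<close>)
  qed
qed

text \<open>
  Applying \<open>x \<mapsto> 2 x + 1\<close> exactly \<open>m\<close> times to the even number \<open>2 n\<close>. Parity shows how often the
  map was applied, so the code determines \<open>m\<close> and \<open>n\<close> without any arithmetic beyond
  doubling.
\<close>

definition pair_code :: "'m \<Rightarrow> 'm \<Rightarrow> 'm" where
  "pair_code m n = recur \<omega> (\<lambda>x. succ_m (dbl x)) (dbl n) m"

lemma pair_code_rec: "DT (\<lambda>s. succ_m (dbl (s 0)))" by (intro df)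

lemma DT_pair_code [df]: "DT f \<Longrightarrow> DT g \<Longrightarrow> DT (\<lambda>s. pair_code (f s) (g s))"
  unfolding pair_code_def by (intro DT_recur pair_code_rec df) auto

lemma pair_code_zero [simp]: "n \<^bold>\<in> \<omega> \<Longrightarrow> pair_code \<^bold>0 n = dbl n"
  unfolding pair_code_def by (rule recur_zero[OF pair_code_rec]) auto

lemma pair_code_succ [simp]: "m \<^bold>\<in> \<omega> \<Longrightarrow> n \<^bold>\<in> \<omega> \<Longrightarrow> pair_code (succ_m m) n = succ_m (dbl (pair_code m n))"
  unfolding pair_code_def by (rule recur_succ[OF pair_code_rec]) auto

lemma pair_code_in_omega [simp]: "m \<^bold>\<in> \<omega> \<Longrightarrow> n \<^bold>\<in> \<omega> \<Longrightarrow> pair_code m n \<^bold>\<in> \<omega>"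
  unfolding pair_code_def by (rule recur_closed[OF pair_code_rec]) auto

lemma pair_code_inject:
  assumes "m \<^bold>\<in> \<omega>" "n \<^bold>\<in> \<omega>" "m' \<^bold>\<in> \<omega>" "n' \<^bold>\<in> \<omega>" "pair_code m n = pair_code m' n'"
  shows "m = m' \<and> n = n'"
proof -
  have ind: "\<forall>m'. m' \<^bold>\<in> \<omega> \<and> pair_code m n = pair_code m' n' \<longrightarrow> m = m' \<and> n = n'"
    using assms(1)
  proof (induction rule: omega_induct)
    case Df
    show ?case by (intro df)
  next
    case zero
    show ?case
    proof (intro allI impI)
      fix m' assume m': "m' \<^bold>\<in> \<omega> \<and> pair_code \<^bold>0 n = pair_code m' n'"
      then consider "m' = \<^bold>0" | k where "k \<^bold>\<in> \<omega>" "m' = succ_m k" using omega_cases by blast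
      then show "\<^bold>0 = m' \<and> n = n'"
      proof cases
        case 1
        then have "dbl n = dbl n'" using m' assms(2,4) by simp
        then show ?thesis using 1 dbl_inject[OF assms(2)] assms(4) by blast
      next
        case 2
        then have "dbl n = succ_m (dbl (pair_code k n'))" using m' assms(2,4) by simp
        then show ?thesis using dbl_ne_succ_dbl[OF assms(2)] pair_code_in_omega[OF 2(1) assms(4)] by blast
      qed
    qed
  next
    case (succ m)
    show ?case
    proof (intro allI impI)
      fix m' assume m': "m' \<^bold>\<in> \<omega> \<and> pair_code (succ_m m) n = pair_code m' n'"
      then consider "m' = \<^bold>0" | k where "k \<^bold>\<in> \<omega>" "m' = succ_m k" using omega_cases by blast
      then show "succ_m m = m' \<and> n = n'"
      proof cases
        case 1
        then have "dbl n' = succ_m (dbl (pair_code m n))" using m' assms(2,4) succ(1) by simp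
        then show ?thesis
          using dbl_ne_succ_dbl[OF assms(4)] pair_code_in_omega[OF succ(1) assms(2)] by blast
      next
        case 2
        then have "dbl (pair_code m n) = dbl (pair_code k n')" using m' assms(2,4) succ(1) by simp
        then have "pair_code m n = pair_code k n'"
          using dbl_inject[OF pair_code_in_omega[OF succ(1) assms(2)]] pair_code_in_omega[OF 2(1) assms(4)] by blast
        then show ?thesis using succ(2) 2 by blast
      qed
    qed
  qed
  show ?thesis using ind assms(3,5) by blast
qed

section \<open>Countability\<close>

definition ctbl :: "'m \<Rightarrow> bool" where
  "ctbl X \<longleftrightarrow> (\<exists>f. fun_m f X \<omega> \<and> (\<forall>x y. x \<^bold>\<in> X \<and> y \<^bold>\<in> X \<and> ap f x = ap f y \<longrightarrow> x = y))"

lemma is_inj_iff: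
  "is_inj (\<^bold>\<in>) f A B \<longleftrightarrow> fun_m f A B \<and> (\<forall>x y. x \<^bold>\<in> A \<and> y \<^bold>\<in> A \<and> ap f x = ap f y \<longrightarrow> x = y)"
proof (cases "fun_m f A B")
  case True
  have "app_m f x = ap f x" if "x \<^bold>\<in> A" for x
    using True that by (rule fun_app(2))
  then show ?thesis unfolding is_inj_def by metis
qed (simp add: is_inj_def)

lemma uncountable_iff: "uncountable (\<^bold>\<in>) X \<longleftrightarrow> \<not> ctbl X"
  by (simp only: uncountable_def ctbl_def is_inj_iff)

lemma Df_ctbl [df]: "DT f \<Longrightarrow> Df (\<lambda>s. ctbl (f s))"
  by (rule Df_comp1[of ctbl]) (unfold ctbl_def, intro df)

text \<open>
  If every element of \<open>X\<close> has codes among the natural numbers, and no two elements share a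
  code, then the least code is an injection. Taking the least one is a definable choice.
\<close>

lemma ctbl_rel:
  assumes "Df (\<lambda>s. R (s 0) (s (Suc 0)))"
    and "\<And>y. y \<^bold>\<in> X \<Longrightarrow> \<exists>k. k \<^bold>\<in> \<omega> \<and> R k y"
    and "\<And>k y y'. k \<^bold>\<in> \<omega> \<Longrightarrow> y \<^bold>\<in> X \<Longrightarrow> y' \<^bold>\<in> X \<Longrightarrow> R k y \<Longrightarrow> R k y' \<Longrightarrow> y = y'"
  shows "ctbl X"
proof -
  let ?P = "\<lambda>y k. R k y \<and> (\<forall>m. m \<^bold>\<in> k \<longrightarrow> \<not> R m y)"
  have Df: "Df (\<lambda>s. ?P (s 0) (s (Suc 0)))" by (intro df Df_comp2[of R, OF assms(1)])
  have "\<exists>!k. k \<^bold>\<in> \<omega> \<and> ?P y k" if y: "y \<^bold>\<in> X" for y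
  proof -
    obtain k where k: "k \<^bold>\<in> \<omega>" "R k y" using assms(2)[OF y] by blast
    have "Df (\<lambda>s. R (s 0) y)" by (rule Df_instance[OF assms(1)])
    from minimal_element[OF this k] obtain j
      where j: "j \<^bold>\<in> \<omega>" "R j y" "\<And>m. m \<^bold>\<in> j \<Longrightarrow> m \<^bold>\<in> \<omega> \<Longrightarrow> \<not> R m y" by blast
    show ?thesis
      using j omega_trans omega_linear by (intro ex1I[of _ j]) blast+
  qed
  from fun_exists_rel[OF Df this] obtain f
    where f: "fun_m f X \<omega>" "\<And>x. x \<^bold>\<in> X \<Longrightarrow> R (ap f x) x" by blast
  have "x = y" if "x \<^bold>\<in> X" "y \<^bold>\<in> X" "ap f x = ap f y" for x y
    using f(2)[of x] f(2)[of y] that assms(3)[OF fun_app(3)[OF f(1)], of x x y] by simp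
  then show ?thesis unfolding ctbl_def using f(1) by blast
qed

lemma ctbl_image2:
  assumes "ctbl A" "ctbl B" "DT (\<lambda>s. h (s 0) (s (Suc 0)))"
    and "\<And>x. x \<^bold>\<in> X \<Longrightarrow> \<exists>a b. a \<^bold>\<in> A \<and> b \<^bold>\<in> B \<and> x = h a b"
  shows "ctbl X"
proof -
  obtain f where f: "fun_m f A \<omega>" "\<And>x y. x \<^bold>\<in> A \<Longrightarrow> y \<^bold>\<in> A \<Longrightarrow> ap f x = ap f y \<Longrightarrow> x = y"
    using assms(1) unfolding ctbl_def by blast
  obtain g where g: "fun_m g B \<omega>" "\<And>x y. x \<^bold>\<in> B \<Longrightarrow> y \<^bold>\<in> B \<Longrightarrow> ap g x = ap g y \<Longrightarrow> x = y"
    using assms(2) unfolding ctbl_def by blast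
  show ?thesis
  proof (rule ctbl_rel[of "\<lambda>k x. \<exists>a b. a \<^bold>\<in> A \<and> b \<^bold>\<in> B \<and> x = h a b \<and> k = pair_code (ap f a) (ap g b)"])
    show "Df (\<lambda>s. \<exists>a b. a \<^bold>\<in> A \<and> b \<^bold>\<in> B \<and> s (Suc 0) = h a b \<and> s 0 = pair_code (ap f a) (ap g b))"
      by (intro df DT_comp2[OF assms(3)])
  next
    fix x assume "x \<^bold>\<in> X"
    then show "\<exists>k. k \<^bold>\<in> \<omega> \<and> (\<exists>a b. a \<^bold>\<in> A \<and> b \<^bold>\<in> B \<and> x = h a b \<and> k = pair_code (ap f a) (ap g b))"
      using assms(4) pair_code_in_omega fun_app(3)[OF f(1)] fun_app(3)[OF g(1)] by blast
  next
    fix k x x'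
    assume "\<exists>a b. a \<^bold>\<in> A \<and> b \<^bold>\<in> B \<and> x = h a b \<and> k = pair_code (ap f a) (ap g b)"
      and "\<exists>a b. a \<^bold>\<in> A \<and> b \<^bold>\<in> B \<and> x' = h a b \<and> k = pair_code (ap f a) (ap g b)"
    then obtain a b a' b' where *: "a \<^bold>\<in> A" "b \<^bold>\<in> B" "x = h a b" "a' \<^bold>\<in> A" "b' \<^bold>\<in> B" "x' = h a' b'"
      "pair_code (ap f a) (ap g b) = pair_code (ap f a') (ap g b')" by auto
    have "ap f a = ap f a' \<and> ap g b = ap g b'"
      by (rule pair_code_inject) (use * fun_app(3)[OF f(1)] fun_app(3)[OF g(1)] in auto)
    then show "x = x'" using * f(2) g(2) by blast
  qed
qed

lemma ctbl_subset: "ctbl A \<Longrightarrow> X \<^bold>\<subseteq> A \<Longrightarrow> ctbl X"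
  by (rule ctbl_image2[of A A "\<lambda>a b. a"]) (assumption, assumption, intro df, auto simp: is_subset_def)

text \<open>
  The only use of Dependent Choice. It is applied to pairs of a number \<open>n\<close> and an injection of
  the \<open>n\<close>-th piece into \<open>\<omega>\<close>, each pair being followed by one for \<open>n + 1\<close>. Dependent Choice does
  not prescribe the first pair; since the pieces increase, a sequence starting late still covers
  everything.
\<close>

lemma ctbl_increasing_union:
  assumes DC: "DC (\<^bold>\<in>)"
    and Df_S: "Df (\<lambda>s. S (s 0) (s (Suc 0)))"
    and S_mono: "\<And>n x. n \<^bold>\<in> \<omega> \<Longrightarrow> x \<^bold>\<in> X \<Longrightarrow> S n x \<Longrightarrow> S (succ_m n) x"
    and cover: "\<And>x. x \<^bold>\<in> X \<Longrightarrow> \<exists>n. n \<^bold>\<in> \<omega> \<and> S n x"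
    and ctbl: "\<And>n. n \<^bold>\<in> \<omega> \<Longrightarrow> ctbl (coll X (S n))"
  shows "ctbl X"
proof -
  have Df': "Df (\<lambda>s. S n (s 0))" for n
    by (rule Df_comp2[of S, OF Df_S]) (intro df)+
  note m = mem_coll[OF Df', of _ X]
  define good where "good p \<longleftrightarrow> (\<exists>n f. p = \<langle>n, f\<rangle> \<and> n \<^bold>\<in> \<omega> \<and>
      (\<forall>x y. x \<^bold>\<in> X \<and> y \<^bold>\<in> X \<and> S n x \<and> S n y \<and> ap f x = ap f y \<longrightarrow> x = y) \<and>
      (\<forall>x. x \<^bold>\<in> X \<and> S n x \<longrightarrow> ap f x \<^bold>\<in> \<omega>))" for p
  define Pfun where "Pfun = Pow_m (cprod (\<^bold>\<in>) X \<omega>)"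
  have Df_good: "Df (\<lambda>s. good (s 0))"
    unfolding good_def by (intro df Df_comp2[of S, OF Df_S])
  let ?A = "coll (cprod (\<^bold>\<in>) \<omega> Pfun) good"
  note mA = mem_coll[OF Df_good, of _ "cprod (\<^bold>\<in>) \<omega> Pfun"]
  let ?R = "\<lambda>p. \<exists>n f f'. p = \<langle>\<langle>n, f\<rangle>, \<langle>succ_m n, f'\<rangle>\<rangle>"
  have "Df (\<lambda>s. ?R (s 0))" by (intro df)
  note mR = mem_coll[OF this, of _ "cprod (\<^bold>\<in>) ?A ?A"]
  have ex: "\<exists>f. \<langle>n, f\<rangle> \<^bold>\<in> ?A" if n: "n \<^bold>\<in> \<omega>" for n
  proof -
    obtain f where f: "fun_m f (coll X (S n)) \<omega>"
      "\<forall>x y. x \<^bold>\<in> coll X (S n) \<and> y \<^bold>\<in> coll X (S n) \<and> ap f x = ap f y \<longrightarrow> x = y"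
      using ctbl[OF n] unfolding ctbl_def by blast
    have "f \<^bold>\<in> Pfun"
      using f(1) unfolding Pfun_def is_fun_def by (auto simp: is_subset_def m)
    moreover have "good \<langle>n, f\<rangle>"
      unfolding good_def using n f fun_app(3)[OF f(1)] unfolding m by auto
    ultimately show ?thesis using n by (auto simp: mA)
  qed
  have "\<exists>F. fun_m F \<omega> ?A \<and>
     (\<forall>n. n \<^bold>\<in> \<omega> \<longrightarrow> \<langle>app_m F n, app_m F (succ_m n)\<rangle> \<^bold>\<in> coll (cprod (\<^bold>\<in>) ?A ?A) ?R)"
  proof (rule DC[unfolded DC_def, rule_format], intro conjI allI impI)
    show "\<exists>x. x \<^bold>\<in> ?A" using ex[OF zero_in_omega] by blast
    fix p assume p: "p \<^bold>\<in> ?A"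
    then obtain n f where nf: "p = \<langle>n, f\<rangle>" "n \<^bold>\<in> \<omega>" by (auto simp: mA)
    obtain f' where f': "\<langle>succ_m n, f'\<rangle> \<^bold>\<in> ?A" using ex[OF succ_in_omega[OF nf(2)]] by blast
    then show "\<exists>y. y \<^bold>\<in> ?A \<and> \<langle>p, y\<rangle> \<^bold>\<in> coll (cprod (\<^bold>\<in>) ?A ?A) ?R"
      using p nf unfolding mR by auto
  qed
  then obtain F where F: "fun_m F \<omega> ?A"
    and step: "\<And>n. n \<^bold>\<in> \<omega> \<Longrightarrow> ?R \<langle>ap F n, ap F (succ_m n)\<rangle>"
    unfolding mR using fun_app(2) by (metis (lifting) succ_in_omega)
  have FA: "good (ap F i)" if "i \<^bold>\<in> \<omega>" for i using fun_app(3)[OF F that] unfolding mA by blast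
  \<comment> \<open>The first components grow by one at each step, so they pass every natural number.\<close>
  have reach: "\<exists>i k f. i \<^bold>\<in> \<omega> \<and> ap F i = \<langle>k, f\<rangle> \<and> k \<^bold>\<in> \<omega> \<and> (k = n \<or> n \<^bold>\<in> k)" if "n \<^bold>\<in> \<omega>" for n
    using that
  proof (induction rule: omega_induct)
    case Df
    show ?case by (intro df)
  next
    case zero
    obtain k f where "ap F \<^bold>0 = \<langle>k, f\<rangle>" "k \<^bold>\<in> \<omega>" using FA[OF zero_in_omega] unfolding good_def by blast
    then show ?case using omega_cases[of k] zero_mem_succ zero_in_omega by blast
  next
    case (succ n)
    then obtain i k f where i: "i \<^bold>\<in> \<omega>" "ap F i = \<langle>k, f\<rangle>" "k \<^bold>\<in> \<omega>" "k = n \<or> n \<^bold>\<in> k" by blast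
    obtain f' where "ap F (succ_m i) = \<langle>succ_m k, f'\<rangle>" using step[OF i(1)] i(2) by auto
    then show ?case using i succ_mem_succ[OF i(3), of n]
      by (intro exI[of _ "succ_m i"] exI[of _ "succ_m k"] exI[of _ f']) auto
  qed
  have mono: "\<forall>n. n \<^bold>\<in> k \<and> S n x \<longrightarrow> S k x" if "k \<^bold>\<in> \<omega>" "x \<^bold>\<in> X" for k x
    using that(1)
  proof (induction rule: omega_induct)
    case Df
    show ?case by (intro df Df_comp2[of S, OF Df_S])
  next
    case zero
    show ?case by simp
  next
    case (succ k)
    then show ?case using S_mono[OF succ(1) that(2)] unfolding mem_succ by blast
  qed
  have goodD: "S k x \<Longrightarrow> ap f x \<^bold>\<in> \<omega>" "S k x \<Longrightarrow> S k y \<Longrightarrow> ap f x = ap f y \<Longrightarrow> x = y"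
    if i: "i \<^bold>\<in> \<omega>" "ap F i = \<langle>k, f\<rangle>" and xy: "x \<^bold>\<in> X" "y \<^bold>\<in> X" for i k f x y
  proof -
    have *: "(\<forall>x y. x \<^bold>\<in> X \<and> y \<^bold>\<in> X \<and> S k x \<and> S k y \<and> ap f x = ap f y \<longrightarrow> x = y) \<and>
      (\<forall>x. x \<^bold>\<in> X \<and> S k x \<longrightarrow> ap f x \<^bold>\<in> \<omega>)"
      using FA[OF i(1)] unfolding i(2) good_def opair_eq_iff by blast
    then show "S k x \<Longrightarrow> ap f x \<^bold>\<in> \<omega>" "S k x \<Longrightarrow> S k y \<Longrightarrow> ap f x = ap f y \<Longrightarrow> x = y"
      using xy by blast+
  qed
  show ?thesis
  proof (rule ctbl_rel[of "\<lambda>j x. \<exists>i k f. i \<^bold>\<in> \<omega> \<and> ap F i = \<langle>k, f\<rangle> \<and> S k x \<and> j = pair_code i (ap f x)"])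
    show "Df (\<lambda>s. \<exists>i k f. i \<^bold>\<in> \<omega> \<and> ap F i = \<langle>k, f\<rangle> \<and> S k (s (Suc 0)) \<and> s 0 = pair_code i (ap f (s (Suc 0))))"
      by (intro df Df_comp2[of S, OF Df_S])
  next
    fix x assume x: "x \<^bold>\<in> X"
    obtain n where n: "n \<^bold>\<in> \<omega>" "S n x" using cover[OF x] by blast
    obtain i k f where i: "i \<^bold>\<in> \<omega>" "ap F i = \<langle>k, f\<rangle>" "k \<^bold>\<in> \<omega>" "k = n \<or> n \<^bold>\<in> k"
      using reach[OF n(1)] by blast
    have "S k x" using mono[OF i(3) x] i(4) n(2) by blast
    moreover from this have "ap f x \<^bold>\<in> \<omega>" using goodD(1)[OF i(1,2) x x] by blast
    ultimately show "\<exists>j. j \<^bold>\<in> \<omega> \<and>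
        (\<exists>i k f. i \<^bold>\<in> \<omega> \<and> ap F i = \<langle>k, f\<rangle> \<and> S k x \<and> j = pair_code i (ap f x))"
      using i(1,2) pair_code_in_omega[OF i(1)] by blast
  next
    fix j x x'
    assume xx: "x \<^bold>\<in> X" "x' \<^bold>\<in> X"
      and "\<exists>i k f. i \<^bold>\<in> \<omega> \<and> ap F i = \<langle>k, f\<rangle> \<and> S k x \<and> j = pair_code i (ap f x)"
      and "\<exists>i k f. i \<^bold>\<in> \<omega> \<and> ap F i = \<langle>k, f\<rangle> \<and> S k x' \<and> j = pair_code i (ap f x')"
    from this(3,4) obtain i k f i' k' f' where *: "i \<^bold>\<in> \<omega>" "ap F i = \<langle>k, f\<rangle>" "S k x"
      "i' \<^bold>\<in> \<omega>" "ap F i' = \<langle>k', f'\<rangle>" "S k' x'" "pair_code i (ap f x) = pair_code i' (ap f' x')" by auto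
    have "ap f x \<^bold>\<in> \<omega>" "ap f' x' \<^bold>\<in> \<omega>"
      using goodD(1)[OF *(1,2) xx *(3)] goodD(1)[OF *(4,5) xx(2,2) *(6)] by blast+
    then have eq: "i = i' \<and> ap f x = ap f' x'" using pair_code_inject[OF *(1) _ *(4) _ *(7)] by blast
    then have "k = k' \<and> f = f'" using *(2,5) by simp
    then show "x = x'" using goodD(2)[OF *(1,2) xx *(3)] *(6) eq by blast
  qed
qed

end

section \<open>Rational vector spaces in the model\<close>

locale rational_space = zf_model E for E :: "'m \<Rightarrow> 'm \<Rightarrow> bool"  (infix \<open>\<^bold>\<in>\<close> 50) +
  fixes K pK tK zK eK V pV zV sV B :: 'm
  assumes vector_space: "is_rat_vector_space (\<^bold>\<in>) K pK tK zK eK V pV zV sV"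
    and basis: "is_basis (\<^bold>\<in>) K zK V pV zV sV B"
begin

abbreviation Q :: "'m ring" where "Q \<equiv> scalars (\<^bold>\<in>) K pK tK zK eK"
abbreviation M :: "('m, 'm) module" where "M \<equiv> vectors (\<^bold>\<in>) V pV zV sV"

text \<open>
  The operations as definable terms; on \<open>V\<close> they agree with those of the module record.
\<close>

definition vadd :: "'m \<Rightarrow> 'm \<Rightarrow> 'm"  (infixl \<open>\<boxplus>\<close> 65) where "u \<boxplus> v = ap pV \<langle>u, v\<rangle>"
definition smul :: "'m \<Rightarrow> 'm \<Rightarrow> 'm"  (infixr \<open>\<boxdot>\<close> 70) where "a \<boxdot> v = ap sV \<langle>a, v\<rangle>"

lemma DT_vadd [df]: "DT f \<Longrightarrow> DT g \<Longrightarrow> DT (\<lambda>s. f s \<boxplus> g s)"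
  unfolding vadd_def by (intro df)

lemma DT_smul [df]: "DT f \<Longrightarrow> DT g \<Longrightarrow> DT (\<lambda>s. f s \<boxdot> g s)"
  unfolding smul_def by (intro df)

lemma field_Q: "field Q" and module_QM: "module Q M"
  and fun_pV: "fun_m pV (cprod (\<^bold>\<in>) V V) V" and fun_sV: "fun_m sV (cprod (\<^bold>\<in>) K V) V"
  and fun_pK: "fun_m pK (cprod (\<^bold>\<in>) K K) K" and fun_tK: "fun_m tK (cprod (\<^bold>\<in>) K K) K"
  using vector_space unfolding is_rat_vector_space_def is_rationals_def Let_def by blast+

sublocale Q: field Q by (rule field_Q)
sublocale M: module Q M by (rule module_QM)

lemma Q_sel: "carrier Q = {x. x \<^bold>\<in> K}" "\<one>\<^bsub>Q\<^esub> = eK" "\<zero>\<^bsub>Q\<^esub> = zK"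
  by (simp_all add: scalars_def)

lemma app2_eq:
  "u \<^bold>\<in> V \<Longrightarrow> v \<^bold>\<in> V \<Longrightarrow> app2 (\<^bold>\<in>) pV u v = u \<boxplus> v"
  "a \<^bold>\<in> K \<Longrightarrow> v \<^bold>\<in> V \<Longrightarrow> app2 (\<^bold>\<in>) sV a v = a \<boxdot> v"
  unfolding app2_def vadd_def smul_def
  using fun_app(2)[OF fun_pV] fun_app(2)[OF fun_sV] by (auto simp: pair_mem_cprod)

lemma M_sel: "carrier M = {x. x \<^bold>\<in> V}" "\<zero>\<^bsub>M\<^esub> = zV"
  "u \<^bold>\<in> V \<Longrightarrow> v \<^bold>\<in> V \<Longrightarrow> u \<oplus>\<^bsub>M\<^esub> v = u \<boxplus> v"
  "a \<^bold>\<in> K \<Longrightarrow> v \<^bold>\<in> V \<Longrightarrow> a \<odot>\<^bsub>M\<^esub> v = a \<boxdot> v"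
  using app2_eq by (simp_all add: vectors_def)

lemma vadd_closed [simp]: "u \<^bold>\<in> V \<Longrightarrow> v \<^bold>\<in> V \<Longrightarrow> u \<boxplus> v \<^bold>\<in> V"
  using M.a_closed[of u v] by (simp add: M_sel)

lemma smul_closed [simp]: "a \<^bold>\<in> K \<Longrightarrow> v \<^bold>\<in> V \<Longrightarrow> a \<boxdot> v \<^bold>\<in> V"
  using M.smult_closed[of a v] by (simp add: M_sel Q_sel)

lemma zV_closed [simp]: "zV \<^bold>\<in> V"
  using M.zero_closed by (simp add: M_sel)

lemma vadd_assoc: "u \<^bold>\<in> V \<Longrightarrow> v \<^bold>\<in> V \<Longrightarrow> w \<^bold>\<in> V \<Longrightarrow> (u \<boxplus> v) \<boxplus> w = u \<boxplus> (v \<boxplus> w)"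
  using M.a_assoc[of u v w] by (simp add: M_sel)

lemma vadd_commute: "u \<^bold>\<in> V \<Longrightarrow> v \<^bold>\<in> V \<Longrightarrow> u \<boxplus> v = v \<boxplus> u"
  using M.a_comm[of u v] by (simp add: M_sel)

lemma vadd_left_commute: "u \<^bold>\<in> V \<Longrightarrow> v \<^bold>\<in> V \<Longrightarrow> w \<^bold>\<in> V \<Longrightarrow> u \<boxplus> (v \<boxplus> w) = v \<boxplus> (u \<boxplus> w)"
  using vadd_assoc vadd_commute by metis

lemmas vadd_ac = vadd_assoc vadd_commute vadd_left_commute

lemma vadd_zero [simp]: "v \<^bold>\<in> V \<Longrightarrow> v \<boxplus> zV = v" "v \<^bold>\<in> V \<Longrightarrow> zV \<boxplus> v = v"
  using M.r_zero[of v] M.l_zero[of v] by (simp_all add: M_sel)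

lemma scalar_closed [simp]:
  "zK \<^bold>\<in> K" "eK \<^bold>\<in> K" "a \<^bold>\<in> K \<Longrightarrow> b \<^bold>\<in> K \<Longrightarrow> a \<oplus>\<^bsub>Q\<^esub> b \<^bold>\<in> K" "a \<^bold>\<in> K \<Longrightarrow> b \<^bold>\<in> K \<Longrightarrow> a \<otimes>\<^bsub>Q\<^esub> b \<^bold>\<in> K"
  "a \<^bold>\<in> K \<Longrightarrow> \<ominus>\<^bsub>Q\<^esub> a \<^bold>\<in> K"
  using Q.zero_closed Q.one_closed Q.a_closed[of a b] Q.m_closed[of a b] Q.a_inv_closed[of a]
  by (simp_all add: Q_sel)

lemma smul_add_left: "a \<^bold>\<in> K \<Longrightarrow> b \<^bold>\<in> K \<Longrightarrow> v \<^bold>\<in> V \<Longrightarrow> (a \<oplus>\<^bsub>Q\<^esub> b) \<boxdot> v = a \<boxdot> v \<boxplus> b \<boxdot> v"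
  using M.smult_l_distr[of a b v] by (simp add: M_sel Q_sel)

lemma smul_add_right: "a \<^bold>\<in> K \<Longrightarrow> u \<^bold>\<in> V \<Longrightarrow> v \<^bold>\<in> V \<Longrightarrow> a \<boxdot> (u \<boxplus> v) = a \<boxdot> u \<boxplus> a \<boxdot> v"
  using M.smult_r_distr[of a u v] by (simp add: M_sel Q_sel)

lemma smul_smul: "a \<^bold>\<in> K \<Longrightarrow> b \<^bold>\<in> K \<Longrightarrow> v \<^bold>\<in> V \<Longrightarrow> a \<boxdot> (b \<boxdot> v) = (a \<otimes>\<^bsub>Q\<^esub> b) \<boxdot> v"
  using M.smult_assoc1[of a b v] by (simp add: M_sel Q_sel)

lemma smul_simps [simp]: "v \<^bold>\<in> V \<Longrightarrow> eK \<boxdot> v = v" "v \<^bold>\<in> V \<Longrightarrow> zK \<boxdot> v = zV" "a \<^bold>\<in> K \<Longrightarrow> a \<boxdot> zV = zV"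
  using M.smult_one[of v] M.smult_l_null[of v] M.smult_r_null[of a] by (simp_all add: M_sel Q_sel)

definition minus_one where "minus_one = \<ominus>\<^bsub>Q\<^esub> eK"

lemma minus_one_closed [simp]: "minus_one \<^bold>\<in> K" by (simp add: minus_one_def)

lemma vadd_minus_one: "v \<^bold>\<in> V \<Longrightarrow> v \<boxplus> minus_one \<boxdot> v = zV"
  using smul_add_left[of eK minus_one v] Q.r_neg[of eK] by (simp add: minus_one_def Q_sel)

lemma minus_one_ne_zero: "minus_one \<noteq> zK"
proof
  assume "minus_one = zK"
  then have "eK = zK" using Q.r_neg[of eK] Q.r_zero[of eK] by (simp add: minus_one_def Q_sel)
  then show False using Q.one_not_zero unfolding Q_sel by blast
qed

lemma scalar_inverse: "a \<^bold>\<in> K \<Longrightarrow> a \<noteq> zK \<Longrightarrow> \<exists>c. c \<^bold>\<in> K \<and> c \<otimes>\<^bsub>Q\<^esub> a = eK"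
proof -
  assume "a \<^bold>\<in> K" "a \<noteq> zK"
  then have "a \<in> Units Q" unfolding Q.field_Units Q_sel by blast
  from Q.Units_l_inv[OF this] Q.Units_inv_closed[OF this] show ?thesis
    unfolding Q_sel by blast
qed

lemma B_sub: "b \<^bold>\<in> B \<Longrightarrow> b \<^bold>\<in> V"
  using basis by (simp add: is_basis_def is_subset_def)

section \<open>Finite sums\<close>

definition bij_m :: "'m \<Rightarrow> 'm \<Rightarrow> 'm \<Rightarrow> bool" where
  "bij_m e n F \<longleftrightarrow> fun_m e n F \<and> (\<forall>x y. x \<^bold>\<in> n \<and> y \<^bold>\<in> n \<and> ap e x = ap e y \<longrightarrow> x = y) \<and>
     (\<forall>y. y \<^bold>\<in> F \<longrightarrow> (\<exists>x. x \<^bold>\<in> n \<and> ap e x = y))"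

lemma is_bij_iff: "is_bij (\<^bold>\<in>) e n F \<longleftrightarrow> bij_m e n F"
proof (cases "fun_m e n F")
  case True
  have "app_m e x = ap e x" if "x \<^bold>\<in> n" for x
    using True that by (rule fun_app(2))
  then show ?thesis unfolding is_bij_def bij_m_def is_inj_iff by (simp cong: conj_cong)
qed (simp add: is_bij_def is_inj_def bij_m_def)

text \<open>
  The data of \<open>is_sum\<close>, expressed by definable terms only.
\<close>

definition partial_sums :: "('m \<Rightarrow> 'm) \<Rightarrow> 'm \<Rightarrow> 'm \<Rightarrow> 'm \<Rightarrow> 'm \<Rightarrow> 'm \<Rightarrow> bool" where
  "partial_sums t F n e g s \<longleftrightarrow> n \<^bold>\<in> \<omega> \<and> bij_m e n F \<and> fun_m g (succ_m n) V \<and> ap g \<^bold>0 = zV \<and>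
     (\<forall>i. i \<^bold>\<in> n \<longrightarrow> ap g (succ_m i) = ap g i \<boxplus> t (ap e i)) \<and> ap g n = s"

definition sum_m :: "('m \<Rightarrow> 'm) \<Rightarrow> 'm \<Rightarrow> 'm \<Rightarrow> bool" where
  "sum_m t F s \<longleftrightarrow> (\<exists>n e g. partial_sums t F n e g s)"

lemma Df_sum0:
  assumes "DT (\<lambda>s. h (s 0) (s (Suc 0)))"
  shows "Df (\<lambda>s. sum_m (h (s 0)) (s (Suc 0)) (s (Suc (Suc 0))))"
  unfolding sum_m_def partial_sums_def bij_m_def by (intro df DT_comp2[of h, OF assms])

lemma is_sum_iff:
  assumes "\<And>a. a \<^bold>\<in> F \<Longrightarrow> t a = t' a" "\<And>a. a \<^bold>\<in> F \<Longrightarrow> t' a \<^bold>\<in> V"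
  shows "is_sum (\<^bold>\<in>) V pV zV F t s \<longleftrightarrow> sum_m t' F s"
proof -
  have "(app_m g \<^bold>0 = zV \<and> (\<forall>i. i \<^bold>\<in> n \<longrightarrow> app_m g (succ_m i) = app2 (\<^bold>\<in>) pV (app_m g i) (t (app_m e i))) \<and>
      app_m g n = s) \<longleftrightarrow>
    (ap g \<^bold>0 = zV \<and> (\<forall>i. i \<^bold>\<in> n \<longrightarrow> ap g (succ_m i) = ap g i \<boxplus> t' (ap e i)) \<and> ap g n = s)"
    if n: "n \<^bold>\<in> \<omega>" and e: "bij_m e n F" and g: "fun_m g (succ_m n) V" for n e g
  proof -
    have e': "fun_m e n F" using e unfolding bij_m_def by blast
    have z: "\<^bold>0 \<^bold>\<in> succ_m n" "n \<^bold>\<in> succ_m n" using zero_mem_succ[OF n] by auto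
    have i: "succ_m i \<^bold>\<in> succ_m n" "i \<^bold>\<in> succ_m n" if "i \<^bold>\<in> n" for i
      using succ_mem_succ[OF n that] that by auto
    have "app_m g (succ_m i) = ap g (succ_m i)"
      "app2 (\<^bold>\<in>) pV (app_m g i) (t (app_m e i)) = ap g i \<boxplus> t' (ap e i)" if "i \<^bold>\<in> n" for i
      using fun_app(2,3)[OF g] i[OF that] fun_app(2,3)[OF e' that] assms
      by (simp_all add: app2_eq)
    then show ?thesis using z fun_app(2)[OF g] by auto
  qed
  then show ?thesis
    unfolding is_sum_def sum_m_def partial_sums_def is_bij_iff by blast
qed

lemma sum_empty: "sum_m t \<^bold>0 zV"
proof -
  obtain e where e: "fun_m e \<^bold>0 \<^bold>0"
    using fun_exists[of "\<lambda>x. x" "\<^bold>0" "\<^bold>0", OF DT_var] by auto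
  obtain g where "fun_m g (succ_m \<^bold>0) V" "\<forall>x. x \<^bold>\<in> succ_m \<^bold>0 \<longrightarrow> ap g x = zV"
    using fun_exists[of "\<lambda>x. zV" "succ_m \<^bold>0" V, OF DT_const] by auto
  then show ?thesis
    using e unfolding sum_m_def partial_sums_def bij_m_def
    by (intro exI[of _ "\<^bold>0"] exI[of _ e] exI[of _ g]) auto
qed

lemma sum_closed: "sum_m t F s \<Longrightarrow> s \<^bold>\<in> V"
  unfolding sum_m_def partial_sums_def using fun_app(3) mem_succ by metis

lemma sum_insert:
  assumes "sum_m t F s" "\<not> b \<^bold>\<in> F" "\<And>a. a \<^bold>\<in> F \<Longrightarrow> t' a = t a" "t' b \<^bold>\<in> V"
  shows "sum_m t' (ins F b) (s \<boxplus> t' b)"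
proof -
  obtain n e g where n: "n \<^bold>\<in> \<omega>" and e: "fun_m e n F"
    and e_inj: "\<And>x y. x \<^bold>\<in> n \<Longrightarrow> y \<^bold>\<in> n \<Longrightarrow> ap e x = ap e y \<Longrightarrow> x = y"
    and e_surj: "\<And>y. y \<^bold>\<in> F \<Longrightarrow> \<exists>x. x \<^bold>\<in> n \<and> ap e x = y"
    and g: "fun_m g (succ_m n) V" "ap g \<^bold>0 = zV" "ap g n = s"
    and g_step: "\<And>i. i \<^bold>\<in> n \<Longrightarrow> ap g (succ_m i) = ap g i \<boxplus> t (ap e i)"
    using assms(1) unfolding sum_m_def partial_sums_def bij_m_def by blast
  have s: "s \<^bold>\<in> V" using sum_closed[OF assms(1)] .
  have "DT (\<lambda>s. if s 0 \<^bold>\<in> n then ap e (s 0) else b)" by (intro df)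
  moreover have "(if i \<^bold>\<in> n then ap e i else b) \<^bold>\<in> ins F b" if "i \<^bold>\<in> succ_m n" for i
    using fun_app(3)[OF e, of i] by auto
  ultimately obtain e' where e': "fun_m e' (succ_m n) (ins F b)"
    "\<And>i. i \<^bold>\<in> succ_m n \<Longrightarrow> ap e' i = (if i \<^bold>\<in> n then ap e i else b)"
    by (rule fun_existsE[where X = "succ_m n" and Y = "ins F b"
          and h = "\<lambda>i. if i \<^bold>\<in> n then ap e i else b"]) (assumption, rule that)
  have "DT (\<lambda>k. if k 0 \<^bold>\<in> succ_m n then ap g (k 0) else s \<boxplus> t' b)" by (intro df)
  moreover have "(if i \<^bold>\<in> succ_m n then ap g i else s \<boxplus> t' b) \<^bold>\<in> V" if "i \<^bold>\<in> succ_m (succ_m n)" for i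
    using fun_app(3)[OF g(1), of i] s assms(4) by simp
  ultimately obtain g' where g': "fun_m g' (succ_m (succ_m n)) V"
    "\<And>i. i \<^bold>\<in> succ_m (succ_m n) \<Longrightarrow> ap g' i = (if i \<^bold>\<in> succ_m n then ap g i else s \<boxplus> t' b)"
    by (rule fun_existsE[where X = "succ_m (succ_m n)" and Y = V
          and h = "\<lambda>i. if i \<^bold>\<in> succ_m n then ap g i else s \<boxplus> t' b"]) (assumption, rule that)
  have bij: "bij_m e' (succ_m n) (ins F b)"
    unfolding bij_m_def
  proof (intro conjI allI impI e'(1))
    fix x y assume "x \<^bold>\<in> succ_m n \<and> y \<^bold>\<in> succ_m n \<and> ap e' x = ap e' y"
    then have xy: "x \<^bold>\<in> succ_m n" "y \<^bold>\<in> succ_m n" "ap e' x = ap e' y" by blast+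
    show "x = y"
    proof (cases "x \<^bold>\<in> n"; cases "y \<^bold>\<in> n")
      assume "x \<^bold>\<in> n" "y \<^bold>\<in> n"
      moreover from this have "ap e x = ap e y" using xy by (simp only: e'(2) if_True)
      ultimately show ?thesis by (rule e_inj)
    next
      assume "x \<^bold>\<in> n" "\<not> y \<^bold>\<in> n"
      moreover from this have "ap e x = b" using xy by (simp only: e'(2) if_True if_False)
      ultimately show ?thesis using fun_app(3)[OF e, of x] assms(2) by blast
    next
      assume "\<not> x \<^bold>\<in> n" "y \<^bold>\<in> n"
      moreover from this have "b = ap e y" using xy by (simp only: e'(2) if_True if_False)
      ultimately show ?thesis using fun_app(3)[OF e, of y] assms(2) by blast
    next
      assume "\<not> x \<^bold>\<in> n" "\<not> y \<^bold>\<in> n"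
      then show ?thesis using xy(1,2) by simp
    qed
  next
    fix y assume y: "y \<^bold>\<in> ins F b"
    show "\<exists>x. x \<^bold>\<in> succ_m n \<and> ap e' x = y"
    proof (cases "y = b")
      case True
      then show ?thesis using e'(2)[of n] by (intro exI[of _ n]) simp
    next
      case False
      then obtain x where "x \<^bold>\<in> n" "ap e x = y" using y e_surj[of y] by auto
      then show ?thesis using e'(2)[of x] by (intro exI[of _ x]) simp
    qed
  qed
  have step: "ap g' (succ_m i) = ap g' i \<boxplus> t' (ap e' i)" if i: "i \<^bold>\<in> succ_m n" for i
  proof (cases "i = n")
    case True
    then show ?thesis using g'(2)[of "succ_m n"] g'(2)[of n] e'(2)[of n] g(3) by simp
  next
    case False
    then have "i \<^bold>\<in> n" using i by simp
    then have "succ_m i \<^bold>\<in> succ_m n" using succ_mem_succ[OF n] by blast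
    then show ?thesis
      using g'(2)[of i] g'(2)[of "succ_m i"] e'(2)[OF i] g_step \<open>i \<^bold>\<in> n\<close> assms(3) fun_app(3)[OF e]
      by simp
  qed
  have ends: "ap g' \<^bold>0 = zV" "ap g' (succ_m n) = s \<boxplus> t' b"
    using g'(2)[of "\<^bold>0"] g'(2)[of "succ_m n"] g(2) zero_mem_succ[OF n] by auto
  show ?thesis
    unfolding sum_m_def partial_sums_def
    by (intro exI[of _ "succ_m n"] exI[of _ e'] exI[of _ g'] conjI allI impI
        bij step ends g'(1) succ_in_omega n)
qed

text \<open>
  Changing one summand by \<open>d\<close> changes by \<open>d\<close> all partial sums from that summand on.
\<close>

lemma sum_modify:
  assumes "sum_m t F s" "c \<^bold>\<in> F" "\<And>a. a \<^bold>\<in> F \<Longrightarrow> a \<noteq> c \<Longrightarrow> t' a = t a" "t' c = t c \<boxplus> d"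
    "d \<^bold>\<in> V" "\<And>a. a \<^bold>\<in> F \<Longrightarrow> t a \<^bold>\<in> V"
  shows "sum_m t' F (s \<boxplus> d)"
proof -
  obtain n e g where n: "n \<^bold>\<in> \<omega>" and e: "bij_m e n F"
    and g: "fun_m g (succ_m n) V" "ap g \<^bold>0 = zV" "ap g n = s"
    and g_step: "\<And>i. i \<^bold>\<in> n \<Longrightarrow> ap g (succ_m i) = ap g i \<boxplus> t (ap e i)"
    using assms(1) unfolding sum_m_def partial_sums_def by blast
  have ef: "fun_m e n F" using e unfolding bij_m_def by blast
  have e_inj: "\<And>x y. x \<^bold>\<in> n \<Longrightarrow> y \<^bold>\<in> n \<Longrightarrow> ap e x = ap e y \<Longrightarrow> x = y"
    using e unfolding bij_m_def by blast
  obtain k where k: "k \<^bold>\<in> n" "ap e k = c" using e assms(2) unfolding bij_m_def by blast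
  have "DT (\<lambda>s. if k \<^bold>\<in> s 0 then ap g (s 0) \<boxplus> d else ap g (s 0))" by (intro df)
  moreover have "(if k \<^bold>\<in> i then ap g i \<boxplus> d else ap g i) \<^bold>\<in> V" if "i \<^bold>\<in> succ_m n" for i
    using fun_app(3)[OF g(1) that] assms(5) by simp
  ultimately obtain g' where g': "fun_m g' (succ_m n) V"
    "\<And>i. i \<^bold>\<in> succ_m n \<Longrightarrow> ap g' i = (if k \<^bold>\<in> i then ap g i \<boxplus> d else ap g i)"
    by (rule fun_existsE[where X = "succ_m n" and Y = V
          and h = "\<lambda>i. if k \<^bold>\<in> i then ap g i \<boxplus> d else ap g i"]) (assumption, rule that)
  have step: "ap g' (succ_m i) = ap g' i \<boxplus> t' (ap e i)" if i: "i \<^bold>\<in> n" for i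
  proof -
    have i': "succ_m i \<^bold>\<in> succ_m n" "i \<^bold>\<in> succ_m n" using succ_mem_succ[OF n i] i by auto
    have V: "ap g i \<^bold>\<in> V" "t (ap e i) \<^bold>\<in> V"
      using fun_app(3)[OF g(1)] i' assms(6) fun_app(3)[OF ef i] by auto
    have ne: "ap e i \<noteq> c" if "k \<noteq> i"
      using e_inj[OF k(1) i] that unfolding k(2) by (blast dest: sym)
    consider "k \<^bold>\<in> i" | "k = i" | "\<not> k \<^bold>\<in> succ_m i" by auto
    then show ?thesis
    proof cases
      case 1
      then have "ap e i \<noteq> c" using ne mem_irrefl[of i] by blast
      then show ?thesis
        using 1 g'(2)[OF i'(1)] g'(2)[OF i'(2)] g_step[OF i] assms(3)[OF fun_app(3)[OF ef i]] V assms(5)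
        by (simp add: vadd_ac)
    next
      case 2
      then show ?thesis
        using g'(2)[OF i'(1)] g'(2)[OF i'(2)] g_step[OF i] assms(4) k(2) V assms(5)
        by (simp add: vadd_ac)
    next
      case 3
      then have "ap e i \<noteq> c" using ne unfolding mem_succ by blast
      then show ?thesis
        using 3 g'(2)[OF i'(1)] g'(2)[OF i'(2)] g_step[OF i] assms(3)[OF fun_app(3)[OF ef i]]
        by simp
    qed
  qed
  have ends: "ap g' \<^bold>0 = zV" "ap g' n = s \<boxplus> d"
    using g'(2)[of "\<^bold>0"] g'(2)[of n] g(2,3) zero_mem_succ[OF n] k(1) by auto
  show ?thesis
    unfolding sum_m_def partial_sums_def
    by (intro exI[of _ n] exI[of _ e] exI[of _ g'] conjI allI impI step ends g'(1) n e)
qed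

text \<open>
  A property of vectors that is kept when a summand is added passes along the partial sums
  to the sum.
\<close>

lemma sum_induct:
  assumes "sum_m t F s" "Df (\<lambda>s. P (s 0))" "P zV"
    and "\<And>v a. v \<^bold>\<in> V \<Longrightarrow> P v \<Longrightarrow> a \<^bold>\<in> F \<Longrightarrow> P (v \<boxplus> t a)"
  shows "P s"
proof -
  obtain n e g where n: "n \<^bold>\<in> \<omega>" and e: "fun_m e n F"
    and g: "fun_m g (succ_m n) V" "ap g \<^bold>0 = zV" "ap g n = s"
    and g_step: "\<And>i. i \<^bold>\<in> n \<Longrightarrow> ap g (succ_m i) = ap g i \<boxplus> t (ap e i)"
    using assms(1) unfolding sum_m_def partial_sums_def bij_m_def by blast
  have "i \<^bold>\<in> succ_m n \<longrightarrow> P (ap g i)" if "i \<^bold>\<in> \<omega>" for i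
    using that
  proof (induction rule: omega_induct)
    case Df
    show ?case by (intro df Df_comp1[OF assms(2)])
  next
    case zero
    then show ?case using assms(3) g(2) by simp
  next
    case (succ i)
    show ?case
    proof
      assume "succ_m i \<^bold>\<in> succ_m n"
      then have i: "i \<^bold>\<in> n" using mem_trans[OF n, of "succ_m i" i] by auto
      then show "P (ap g (succ_m i))"
        using succ g_step[OF i] assms(4)[of "ap g i" "ap e i"] fun_app(3)[OF g(1), of i] fun_app(3)[OF e i]
        by simp
    qed
  qed
  then show ?thesis using n g(3) by auto
qed

section \<open>Spans\<close>

definition lin_comb :: "'m \<Rightarrow> 'm \<Rightarrow> 'm \<Rightarrow> bool" where
  "lin_comb F q v \<longleftrightarrow> fun_m q F K \<and> sum_m (\<lambda>a. ap q a \<boxdot> a) F v"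

lemma is_lin_comb_iff:
  assumes "F \<^bold>\<subseteq> B"
  shows "is_lin_comb (\<^bold>\<in>) K V pV zV sV F q v \<longleftrightarrow> lin_comb F q v"
proof (cases "fun_m q F K")
  case True
  have F: "a \<^bold>\<in> V" if "a \<^bold>\<in> F" for a using assms that B_sub unfolding is_subset_def by blast
  have "is_sum (\<^bold>\<in>) V pV zV F (\<lambda>a. app2 (\<^bold>\<in>) sV (app_m q a) a) v \<longleftrightarrow> sum_m (\<lambda>a. ap q a \<boxdot> a) F v"
    by (rule is_sum_iff) (simp_all add: fun_app(2,3)[OF True] app2_eq F)
  then show ?thesis by (simp add: is_lin_comb_def lin_comb_def)
qed (simp add: is_lin_comb_def lin_comb_def)

lemma Df_lin_comb0: "Df (\<lambda>s. lin_comb (s 0) (s (Suc 0)) (s (Suc (Suc 0))))"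
proof -
  have "DT (\<lambda>s. ap (s 0) (s (Suc 0)) \<boxdot> s (Suc 0))" by (intro df)
  then show ?thesis
    unfolding lin_comb_def
    by (intro df Df_comp3[OF Df_sum0[of "\<lambda>q a. ap q a \<boxdot> a"]])
qed

lemmas Df_lin_comb [df] = Df_comp3[OF Df_lin_comb0]

lemma independent:
  assumes "F \<^bold>\<subseteq> B" "lin_comb F q zV" "b \<^bold>\<in> F"
  shows "ap q b = zK"
proof -
  have "app_m q b = zK"
    using basis assms is_lin_comb_iff[OF assms(1)] unfolding is_basis_def by blast
  then show ?thesis using fun_app(2)[of q F K b] assms(2,3) by (simp add: lin_comb_def)
qed

text \<open>
  Elements of \<open>A\<close> outside the basis are ignored, so that \<open>A\<close> may be an arbitrary set.
\<close>

definition span :: "'m \<Rightarrow> 'm \<Rightarrow> bool" where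
  "span A v \<longleftrightarrow> (\<exists>F q. F \<^bold>\<subseteq> A \<and> F \<^bold>\<subseteq> B \<and> lin_comb F q v)"

lemma Df_span [df]: "DT f \<Longrightarrow> DT g \<Longrightarrow> Df (\<lambda>s. span (f s) (g s))"
  by (rule Df_comp2[of span]) (unfold span_def, intro df)

lemma span_B: "v \<^bold>\<in> V \<Longrightarrow> span B v"
  using basis is_lin_comb_iff unfolding span_def is_basis_def by blast

lemma span_closed: "span A v \<Longrightarrow> v \<^bold>\<in> V"
  unfolding span_def lin_comb_def using sum_closed by blast

lemma span_zero: "span A zV"
proof -
  obtain q where "fun_m q \<^bold>0 K"
    using fun_exists[of "\<lambda>x. x" "\<^bold>0" K, OF DT_var] by auto
  then show ?thesis
    using sum_empty unfolding span_def lin_comb_def is_subset_def by (metis mem_emp)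
qed

text \<open>
  A linear combination has one coefficient for each vector, so there are two cases: either \<open>c\<close>
  is appended to the summands, or its coefficient is changed.
\<close>

lemma span_add_multiple:
  assumes "span A v" "c \<^bold>\<in> A" "c \<^bold>\<in> B" "a \<^bold>\<in> K"
  shows "span A (v \<boxplus> a \<boxdot> c)"
proof -
  obtain F q where F: "F \<^bold>\<subseteq> A" "F \<^bold>\<subseteq> B" and q: "fun_m q F K" and s: "sum_m (\<lambda>a. ap q a \<boxdot> a) F v"
    using assms(1) unfolding span_def lin_comb_def by blast
  have FV: "x \<^bold>\<in> V" if "x \<^bold>\<in> F" for x using F(2) that B_sub unfolding is_subset_def by blast
  have c: "c \<^bold>\<in> V" using assms(3) B_sub by blast
  show ?thesis
  proof (cases "c \<^bold>\<in> F")
    case False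
    have "DT (\<lambda>s. if s 0 = c then a else ap q (s 0))" by (intro df)
    moreover have "(if x = c then a else ap q x) \<^bold>\<in> K" if "x \<^bold>\<in> ins F c" for x
      using fun_app(3)[OF q, of x] assms(4) that by auto
    ultimately obtain q' where q': "fun_m q' (ins F c) K"
      "\<And>x. x \<^bold>\<in> ins F c \<Longrightarrow> ap q' x = (if x = c then a else ap q x)"
      by (rule fun_existsE[where X = "ins F c" and Y = K and h = "\<lambda>x. if x = c then a else ap q x"])
        (assumption, rule that)
    have qc: "ap q' c = a" using q'(2)[of c] by simp
    have qF: "ap q' x = ap q x" if "x \<^bold>\<in> F" for x using q'(2)[of x] that False by auto
    have "sum_m (\<lambda>a. ap q' a \<boxdot> a) (ins F c) (v \<boxplus> ap q' c \<boxdot> c)"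
      by (rule sum_insert[OF s False]) (simp_all add: qc qF c assms(4))
    then have "lin_comb (ins F c) q' (v \<boxplus> a \<boxdot> c)"
      using q'(1) unfolding lin_comb_def qc by blast
    moreover have "ins F c \<^bold>\<subseteq> A" "ins F c \<^bold>\<subseteq> B"
      using F assms(2,3) unfolding is_subset_def by auto
    ultimately show ?thesis unfolding span_def by blast
  next
    case True
    let ?k = "ap q c \<oplus>\<^bsub>Q\<^esub> a"
    have k: "?k \<^bold>\<in> K" using fun_app(3)[OF q True] assms(4) by simp
    have "DT (\<lambda>s. if s 0 = c then ?k else ap q (s 0))" by (intro df)
    moreover have "(if x = c then ?k else ap q x) \<^bold>\<in> K" if "x \<^bold>\<in> F" for x
      using fun_app(3)[OF q that] k by simp
    ultimately obtain q' where q': "fun_m q' F K"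
      "\<And>x. x \<^bold>\<in> F \<Longrightarrow> ap q' x = (if x = c then ?k else ap q x)"
      by (rule fun_existsE[where X = F and Y = K and h = "\<lambda>x. if x = c then ?k else ap q x"])
        (assumption, rule that)
    have "sum_m (\<lambda>a. ap q' a \<boxdot> a) F (v \<boxplus> a \<boxdot> c)"
    proof (rule sum_modify[OF s True])
      show "ap q' x \<boxdot> x = ap q x \<boxdot> x" if "x \<^bold>\<in> F" "x \<noteq> c" for x
        using q'(2)[OF that(1)] that(2) by simp
      show "ap q' c \<boxdot> c = ap q c \<boxdot> c \<boxplus> a \<boxdot> c"
        using q'(2)[OF True] smul_add_left[OF fun_app(3)[OF q True] assms(4) c] by simp
      show "ap q x \<boxdot> x \<^bold>\<in> V" if "x \<^bold>\<in> F" for x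
        using fun_app(3)[OF q that] FV[OF that] by simp
      show "a \<boxdot> c \<^bold>\<in> V" using assms(4) c by simp
    qed
    then show ?thesis using q'(1) F unfolding span_def lin_comb_def by blast
  qed
qed

text \<open>
  A span is reached from zero by adding multiples of basis vectors one at a time. The rule hides
  the enumerations and coefficient functions of linear combinations.
\<close>

lemma span_induct [consumes 1, case_names Df zero step]:
  assumes "span A v" "Df (\<lambda>s. P (s 0))" "P zV"
    and "\<And>v c a. v \<^bold>\<in> V \<Longrightarrow> P v \<Longrightarrow> c \<^bold>\<in> A \<Longrightarrow> c \<^bold>\<in> B \<Longrightarrow> a \<^bold>\<in> K \<Longrightarrow> P (v \<boxplus> a \<boxdot> c)"
  shows "P v"
proof -
  obtain F q where F: "F \<^bold>\<subseteq> A" "F \<^bold>\<subseteq> B" and q: "fun_m q F K" and s: "sum_m (\<lambda>a. ap q a \<boxdot> a) F v"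
    using assms(1) unfolding span_def lin_comb_def by blast
  from s assms(2,3) show ?thesis
  proof (rule sum_induct)
    fix v a assume "v \<^bold>\<in> V" "P v" "a \<^bold>\<in> F"
    then show "P (v \<boxplus> ap q a \<boxdot> a)"
      using assms(4)[of v a "ap q a"] F fun_app(3)[OF q] unfolding is_subset_def by blast
  qed
qed

lemmas V_induct [consumes 1, case_names Df zero step] = span_induct[OF span_B]

lemma span_add:
  assumes "span A u" "span A v"
  shows "span A (u \<boxplus> v)"
  using assms(2)
proof (induction rule: span_induct)
  case Df
  show ?case by (intro df)
next
  case zero
  then show ?case using assms(1) span_closed[OF assms(1)] by simp
next
  case (step v c a)
  have "u \<boxplus> (v \<boxplus> a \<boxdot> c) = (u \<boxplus> v) \<boxplus> a \<boxdot> c"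
    using step B_sub[of c] span_closed[OF assms(1)] by (simp add: vadd_assoc)
  then show ?case using span_add_multiple[OF step(5,2,3,4)] by simp
qed

lemma span_smul:
  assumes "span A v" "k \<^bold>\<in> K"
  shows "span A (k \<boxdot> v)"
  using assms(1)
proof (induction rule: span_induct)
  case Df
  show ?case by (intro df)
next
  case zero
  then show ?case using span_zero assms(2) by simp
next
  case (step v c a)
  have "k \<boxdot> (v \<boxplus> a \<boxdot> c) = k \<boxdot> v \<boxplus> (k \<otimes>\<^bsub>Q\<^esub> a) \<boxdot> c"
    using step B_sub[of c] assms(2) by (simp add: smul_add_right smul_smul)
  then show ?case using span_add_multiple[OF step(5,2,3), of "k \<otimes>\<^bsub>Q\<^esub> a"] step(4) assms(2) by simp
qed

lemma span_multiple:
  assumes "c \<^bold>\<in> A" "c \<^bold>\<in> B" "a \<^bold>\<in> K"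
  shows "span A (a \<boxdot> c)"
  using span_add_multiple[OF span_zero assms] B_sub[OF assms(2)] assms(3) by simp

lemma span_cancel:
  assumes "span A u" "span A (u \<boxplus> x)" "x \<^bold>\<in> V"
  shows "span A x"
proof -
  have u: "u \<^bold>\<in> V" using span_closed assms(1) by blast
  have "(u \<boxplus> x) \<boxplus> minus_one \<boxdot> u = x \<boxplus> (u \<boxplus> minus_one \<boxdot> u)"
    using u assms(3) by (simp add: vadd_ac)
  then have "(u \<boxplus> x) \<boxplus> minus_one \<boxdot> u = x" using vadd_minus_one[OF u] assms(3) by simp
  then show ?thesis using span_add[OF assms(2) span_smul[OF assms(1) minus_one_closed]] by simp
qed

lemma span_mono: "span A v \<Longrightarrow> A \<^bold>\<subseteq> A' \<Longrightarrow> span A' v"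
  unfolding span_def is_subset_def by blast

section \<open>Coordinate hyperplanes\<close>

text \<open>
  The kernel of the coordinate functional of \<open>b\<close>: the vectors without \<open>b\<close> in their support.
\<close>

definition hyperplane :: "'m \<Rightarrow> 'm \<Rightarrow> bool" where
  "hyperplane b v \<longleftrightarrow> span (coll B (\<lambda>x. x \<noteq> b)) v"

lemma mem_others: "x \<^bold>\<in> coll B (\<lambda>x. x \<noteq> b) \<longleftrightarrow> x \<^bold>\<in> B \<and> x \<noteq> b"
  by (rule mem_coll) (intro df)

lemma Df_hyp [df]: "DT f \<Longrightarrow> DT g \<Longrightarrow> Df (\<lambda>s. hyperplane (f s) (g s))"
proof (rule Df_comp2[of hyperplane])
  have "Df (\<lambda>s. s 0 \<noteq> s (Suc 0))" by (intro df)
  then have "DT (\<lambda>s. coll B (\<lambda>x. x \<noteq> s 0))" by (rule DT_coll[of "\<lambda>x b. x \<noteq> b"])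
  from DT_comp1[of "\<lambda>b. coll B (\<lambda>x. x \<noteq> b)", OF this DT_var[of 0]]
  show "Df (\<lambda>s. hyperplane (s 0) (s (Suc 0)))" unfolding hyperplane_def by (intro df)
qed

lemma hyp_multiple: "c \<^bold>\<in> B \<Longrightarrow> c \<noteq> b \<Longrightarrow> a \<^bold>\<in> K \<Longrightarrow> hyperplane b (a \<boxdot> c)"
  unfolding hyperplane_def by (rule span_multiple) (auto simp: mem_others)

lemma hyp_add: "hyperplane b u \<Longrightarrow> hyperplane b v \<Longrightarrow> hyperplane b (u \<boxplus> v)"
  unfolding hyperplane_def by (rule span_add)

lemma hyp_cancel: "hyperplane b u \<Longrightarrow> hyperplane b (u \<boxplus> x) \<Longrightarrow> x \<^bold>\<in> V \<Longrightarrow> hyperplane b x"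
  unfolding hyperplane_def by (rule span_cancel)

lemma hyp_zero: "hyperplane b zV"
  unfolding hyperplane_def by (rule span_zero)

text \<open>
  Otherwise, appending \<open>b\<close> with the coefficient \<open>- 1\<close> to a linear combination of the other basis
  vectors would give a nontrivial representation of zero.
\<close>

lemma basis_not_hyp:
  assumes b: "b \<^bold>\<in> B"
  shows "\<not> hyperplane b b"
proof
  assume "hyperplane b b"
  then obtain F q where F: "F \<^bold>\<subseteq> coll B (\<lambda>x. x \<noteq> b)" "F \<^bold>\<subseteq> B" and q: "fun_m q F K"
    and s: "sum_m (\<lambda>a. ap q a \<boxdot> a) F b"
    unfolding hyperplane_def span_def lin_comb_def by blast
  have nb: "\<not> b \<^bold>\<in> F" using F(1) unfolding is_subset_def mem_others by blast
  have bV: "b \<^bold>\<in> V" using B_sub b by blast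
  have "DT (\<lambda>s. if s 0 = b then minus_one else ap q (s 0))" by (intro df)
  moreover have "(if x = b then minus_one else ap q x) \<^bold>\<in> K" if "x \<^bold>\<in> ins F b" for x
    using fun_app(3)[OF q, of x] that by auto
  ultimately obtain q' where q': "fun_m q' (ins F b) K"
    "\<And>x. x \<^bold>\<in> ins F b \<Longrightarrow> ap q' x = (if x = b then minus_one else ap q x)"
    by (rule fun_existsE[where X = "ins F b" and Y = K and h = "\<lambda>x. if x = b then minus_one else ap q x"])
      (assumption, rule that)
  have qb: "ap q' b = minus_one" using q'(2)[of b] by simp
  have qF: "ap q' x = ap q x" if "x \<^bold>\<in> F" for x using q'(2)[of x] that nb by auto
  have "sum_m (\<lambda>a. ap q' a \<boxdot> a) (ins F b) (b \<boxplus> ap q' b \<boxdot> b)"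
    by (rule sum_insert[OF s nb]) (simp_all add: qb qF bV)
  then have "lin_comb (ins F b) q' zV"
    using q'(1) vadd_minus_one[OF bV] unfolding lin_comb_def qb by simp
  moreover have "ins F b \<^bold>\<subseteq> B" using F(2) b unfolding is_subset_def by auto
  ultimately show False using independent[of "ins F b" q' b] minus_one_ne_zero qb by simp
qed

lemma hyp_multiple_zero:
  assumes "b \<^bold>\<in> B" "a \<^bold>\<in> K" "hyperplane b (a \<boxdot> b)"
  shows "a = zK"
proof (rule ccontr)
  assume "a \<noteq> zK"
  then obtain c where c: "c \<^bold>\<in> K" "c \<otimes>\<^bsub>Q\<^esub> a = eK" using scalar_inverse assms(2) by blast
  have "hyperplane b (c \<boxdot> (a \<boxdot> b))" using assms(3) c(1) unfolding hyperplane_def by (rule span_smul)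
  then have "hyperplane b b" using c assms(1,2) B_sub[of b] by (simp add: smul_smul)
  then show False using basis_not_hyp assms(1) by blast
qed

text \<open>
  The multiple of \<open>b\<close> split off here is the coordinate of \<open>v\<close> at \<open>b\<close>.
\<close>

lemma hyp_decompose:
  assumes "b \<^bold>\<in> B" "v \<^bold>\<in> V"
  shows "\<exists>h a. hyperplane b h \<and> a \<^bold>\<in> K \<and> v = h \<boxplus> a \<boxdot> b"
  using assms(2)
proof (induction rule: V_induct)
  case Df
  show ?case by (intro df)
next
  case zero
  show ?case using hyp_zero B_sub[OF assms(1)]
    by (intro exI[of _ zV] exI[of _ zK]) simp
next
  case (step v c a)
  obtain h k where h: "hyperplane b h" "k \<^bold>\<in> K" "v = h \<boxplus> k \<boxdot> b" using step(5) by blast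
  have V: "h \<^bold>\<in> V" "b \<^bold>\<in> V" "c \<^bold>\<in> V"
    using h(1) span_closed B_sub assms(1) step(3) unfolding hyperplane_def by blast+
  show ?case
  proof (cases "c = b")
    case True
    have "v \<boxplus> a \<boxdot> c = h \<boxplus> (k \<oplus>\<^bsub>Q\<^esub> a) \<boxdot> b"
      using True V h(2) step(4) unfolding h(3) by (simp add: vadd_assoc smul_add_left)
    then show ?thesis using h(1,2) step(4) scalar_closed(3) by blast
  next
    case False
    have "v \<boxplus> a \<boxdot> c = (h \<boxplus> a \<boxdot> c) \<boxplus> k \<boxdot> b"
      using V h(2) step(4) unfolding h(3) by (simp add: vadd_ac)
    then show ?thesis using h(1,2) hyp_add[OF h(1) hyp_multiple[OF step(3) False step(4)]] by blast
  qed
qed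

section \<open>Finite sets of basis vectors\<close>

text \<open>
  Finite subsets of the basis as the least family containing the empty set and closed under
  insertion of basis vectors, which gives an induction rule without counting.
\<close>

definition fin_basis :: "'m \<Rightarrow> bool" where
  "fin_basis D \<longleftrightarrow> (\<forall>U. \<^bold>0 \<^bold>\<in> U \<and> (\<forall>D b. D \<^bold>\<in> U \<and> b \<^bold>\<in> B \<longrightarrow> ins D b \<^bold>\<in> U) \<longrightarrow> D \<^bold>\<in> U)"

lemma Df_fin [df]: "DT f \<Longrightarrow> Df (\<lambda>s. fin_basis (f s))"
  by (rule Df_comp1[of fin_basis]) (unfold fin_basis_def, intro df)

lemma fin_empty: "fin_basis \<^bold>0"
  unfolding fin_basis_def by blast

lemma fin_ins: "fin_basis D \<Longrightarrow> b \<^bold>\<in> B \<Longrightarrow> fin_basis (ins D b)"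
  unfolding fin_basis_def by blast

lemma fin_induct [consumes 1, case_names Df empty ins]:
  assumes "fin_basis D" "Df (\<lambda>s. P (s 0))" "P \<^bold>0"
    and "\<And>D b. fin_basis D \<Longrightarrow> P D \<Longrightarrow> b \<^bold>\<in> B \<Longrightarrow> P (ins D b)"
  shows "P D"
proof -
  have "Df (\<lambda>s. fin_basis (s 0) \<and> P (s 0))" by (intro df Df_comp1[OF assms(2)])
  note m = mem_coll[of "\<lambda>D. fin_basis D \<and> P D", OF this, of _ "Pow_m B"]
  have "D \<^bold>\<in> coll (Pow_m B) (\<lambda>D. fin_basis D \<and> P D)"
    by (rule assms(1)[unfolded fin_basis_def, rule_format], unfold m)
       (use assms(3,4) fin_empty fin_ins in \<open>auto simp: is_subset_def\<close>)
  then show ?thesis unfolding m by blast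
qed

lemma fin_span_exists:
  assumes "v \<^bold>\<in> V" "fin_basis D"
  shows "\<exists>D'. fin_basis D' \<and> D \<^bold>\<subseteq> D' \<and> span D' v"
  using assms(1)
proof (induction rule: V_induct)
  case Df
  show ?case by (intro df)
next
  case zero
  show ?case using assms(2) span_zero unfolding is_subset_def by blast
next
  case (step v c a)
  then obtain D' where D': "fin_basis D'" "D \<^bold>\<subseteq> D'" "span D' v" by blast
  have "span (ins D' c) v" by (rule span_mono[OF D'(3)]) (simp add: is_subset_def)
  then have "span (ins D' c) (v \<boxplus> a \<boxdot> c)"
    using span_add_multiple step(3,4) by simp
  then show ?case using fin_ins[OF D'(1) step(3)] D'(2) unfolding is_subset_def by (metis mem_ins)
qed

lemma span_ins_decompose:
  assumes "span (ins D b) v" "b \<^bold>\<in> B"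
  shows "\<exists>h a. span D h \<and> a \<^bold>\<in> K \<and> v = h \<boxplus> a \<boxdot> b"
  using assms(1)
proof (induction rule: span_induct)
  case Df
  show ?case by (intro df)
next
  case zero
  show ?case using span_zero B_sub[OF assms(2)]
    by (intro exI[of _ zV] exI[of _ zK]) simp
next
  case (step v c a)
  obtain h k where h: "span D h" "k \<^bold>\<in> K" "v = h \<boxplus> k \<boxdot> b" using step(5) by blast
  have V: "h \<^bold>\<in> V" "b \<^bold>\<in> V" "c \<^bold>\<in> V"
    using h(1) span_closed B_sub assms(2) step(3) by blast+
  show ?case
  proof (cases "c = b")
    case True
    have "v \<boxplus> a \<boxdot> c = h \<boxplus> (k \<oplus>\<^bsub>Q\<^esub> a) \<boxdot> b"
      using True V h(2) step(4) unfolding h(3) by (simp add: vadd_assoc smul_add_left)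
    then show ?thesis using h(1,2) step(4) scalar_closed(3) by blast
  next
    case False
    have "v \<boxplus> a \<boxdot> c = (h \<boxplus> a \<boxdot> c) \<boxplus> k \<boxdot> b"
      using V h(2) step(4) unfolding h(3) by (simp add: vadd_ac)
    moreover have "c \<^bold>\<in> D" using step(2) False by simp
    ultimately show ?thesis
      using h(2) span_add_multiple[OF h(1) _ step(3,4)] by blast
  qed
qed

section \<open>Vectors with support in a given finite set\<close>

text \<open>
  The support of \<open>v\<close> is contained in \<open>D\<close>.
\<close>

definition supported :: "'m \<Rightarrow> 'm \<Rightarrow> bool" where
  "supported D v \<longleftrightarrow> v \<^bold>\<in> V \<and> (\<forall>b. b \<^bold>\<in> B \<and> \<not> b \<^bold>\<in> D \<longrightarrow> hyperplane b v)"

lemma Df_supported [df]: "DT f \<Longrightarrow> DT g \<Longrightarrow> Df (\<lambda>s. supported (f s) (g s))"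
  by (rule Df_comp2[of supported]) (unfold supported_def, intro df)

lemma mem_supported: "x \<^bold>\<in> coll V (supported D) \<longleftrightarrow> supported D x"
proof -
  have "Df (\<lambda>s. supported D (s 0))" by (intro df)
  then show ?thesis using mem_coll by (auto simp: supported_def)
qed

lemma span_hyp: "span D v \<Longrightarrow> \<not> b \<^bold>\<in> D \<Longrightarrow> hyperplane b v"
  unfolding hyperplane_def span_def is_subset_def mem_others by blast

lemma span_supported: "span D v \<Longrightarrow> supported D v"
  unfolding supported_def using span_hyp span_closed by blast

lemma supported_mono: "supported D v \<Longrightarrow> D \<^bold>\<subseteq> D' \<Longrightarrow> supported D' v"
  unfolding supported_def is_subset_def by blast

lemma supported_zero: "supported D zV"
  by (rule span_supported[OF span_zero])

lemma supported_add: "supported D u \<Longrightarrow> supported D v \<Longrightarrow> supported D (u \<boxplus> v)"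
  unfolding supported_def using hyp_add by simp

lemma supported_multiple: "b \<^bold>\<in> D \<Longrightarrow> b \<^bold>\<in> B \<Longrightarrow> a \<^bold>\<in> K \<Longrightarrow> supported D (a \<boxdot> b)"
  by (rule span_supported[OF span_multiple])

text \<open>
  A vector all of whose coordinates vanish is zero. It lies in the span of a finite set \<open>D\<close>, and
  the elements of \<open>D\<close> can be removed one at a time, since their coefficients vanish.
\<close>

lemma hyp_all_zero:
  assumes "v \<^bold>\<in> V" "\<And>b. b \<^bold>\<in> B \<Longrightarrow> hyperplane b v"
  shows "v = zV"
proof -
  obtain D where D: "fin_basis D" "span D v" using fin_span_exists[OF assms(1) fin_empty] by blast
  have "\<forall>v. span D v \<and> (\<forall>b. b \<^bold>\<in> B \<longrightarrow> hyperplane b v) \<longrightarrow> v = zV"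
    using D(1)
  proof (induction rule: fin_induct)
    case Df
    show ?case by (intro df)
  next
    case empty
    have "v = zV" if "span \<^bold>0 v" for v
      using that
    proof (induction rule: span_induct)
      case Df
      show ?case by (intro df)
    qed simp_all
    then show ?case by blast
  next
    case (ins D b)
    show ?case
    proof (intro allI impI)
      fix v assume v: "span (ins D b) v \<and> (\<forall>b. b \<^bold>\<in> B \<longrightarrow> hyperplane b v)"
      show "v = zV"
      proof (cases "b \<^bold>\<in> D")
        case True
        then have "ins D b = D" by (intro ext_m) auto
        then show ?thesis using ins(3) v by simp
      next
        case False
        obtain h a where h: "span D h" "a \<^bold>\<in> K" "v = h \<boxplus> a \<boxdot> b"
          using span_ins_decompose[of D b v] v ins(2) by blast
        have V: "b \<^bold>\<in> V" "h \<^bold>\<in> V" using B_sub[OF ins(2)] span_closed[OF h(1)] by blast+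
        have "hyperplane b (a \<boxdot> b)"
          by (rule hyp_cancel[OF span_hyp[OF h(1) False]]) (use v ins(2) h V in auto)
        then have "a = zK" using hyp_multiple_zero ins(2) h(2) by blast
        then have "v = h" using h(3) V by simp
        then show ?thesis using ins(3) v h(1) by blast
      qed
    qed
  qed
  then show ?thesis using D(2) assms(2) by blast
qed

text \<open>
  Addition and multiplication of scalars as definable terms.
\<close>

definition kadd where "kadd a b = ap pK \<langle>a, b\<rangle>"
definition kmul where "kmul a b = ap tK \<langle>a, b\<rangle>"

lemma DT_kadd [df]: "DT f \<Longrightarrow> DT g \<Longrightarrow> DT (\<lambda>s. kadd (f s) (g s))"
  unfolding kadd_def by (intro df)

lemma DT_kmul [df]: "DT f \<Longrightarrow> DT g \<Longrightarrow> DT (\<lambda>s. kmul (f s) (g s))"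
  unfolding kmul_def by (intro df)

lemma kadd_kmul_eq:
  assumes "a \<^bold>\<in> K" "b \<^bold>\<in> K"
  shows "kadd a b = a \<oplus>\<^bsub>Q\<^esub> b" "kmul a b = a \<otimes>\<^bsub>Q\<^esub> b"
  using fun_app(2)[OF fun_pK, of "\<langle>a, b\<rangle>"] fun_app(2)[OF fun_tK, of "\<langle>a, b\<rangle>"] assms
  by (simp_all add: kadd_def kmul_def scalars_def app2_def pair_mem_cprod)

lemma fraction_cleared:
  assumes "a \<in> carrier Q" "b \<in> carrier Q" "c \<in> Units Q"
  shows "((a \<ominus>\<^bsub>Q\<^esub> b) \<otimes>\<^bsub>Q\<^esub> inv\<^bsub>Q\<^esub> c) \<otimes>\<^bsub>Q\<^esub> c \<oplus>\<^bsub>Q\<^esub> b = a"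
proof -
  have "((a \<ominus>\<^bsub>Q\<^esub> b) \<otimes>\<^bsub>Q\<^esub> inv\<^bsub>Q\<^esub> c) \<otimes>\<^bsub>Q\<^esub> c = a \<ominus>\<^bsub>Q\<^esub> b"
    using assms by (simp add: Q.m_assoc Q.Units_closed)
  then show ?thesis
    using assms by (simp add: Q.minus_eq Q.a_assoc Q.l_neg)
qed

text \<open>
  A fraction \<open>q = (l - m) / n\<close> is coded by \<open>l\<close>, \<open>m\<close> and \<open>n\<close>. The coding relation is written
  without division as \<open>q n + m = l\<close>, which is visibly definable and determines \<open>q\<close>.
\<close>

lemma ctbl_scalars: "ctbl K"
proof -
  obtain \<iota> where i: "fun_m \<iota> \<omega> K"
    and nz: "\<And>n. n \<^bold>\<in> \<omega> \<Longrightarrow> n \<noteq> \<^bold>0 \<Longrightarrow> app_m \<iota> n \<noteq> \<zero>\<^bsub>Q\<^esub>"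
    and frac: "\<And>q. q \<^bold>\<in> K \<Longrightarrow> \<exists>l m n. l \<^bold>\<in> \<omega> \<and> m \<^bold>\<in> \<omega> \<and> n \<^bold>\<in> \<omega> \<and> n \<noteq> \<^bold>0 \<and>
             q = (app_m \<iota> l \<ominus>\<^bsub>Q\<^esub> app_m \<iota> m) \<otimes>\<^bsub>Q\<^esub> inv\<^bsub>Q\<^esub> app_m \<iota> n"
    using vector_space unfolding is_rat_vector_space_def is_rationals_def Let_def by blast
  note ia = fun_app(2)[OF i]
  have iK: "ap \<iota> n \<^bold>\<in> K" if "n \<^bold>\<in> \<omega>" for n using fun_app(3)[OF i that] .
  have iU: "ap \<iota> n \<in> Units Q" if "n \<^bold>\<in> \<omega>" "n \<noteq> \<^bold>0" for n
    using nz[OF that] iK[OF that(1)] ia[OF that(1)] unfolding Q.field_Units Q_sel by simp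
  let ?R = "\<lambda>k q. \<exists>l m n. l \<^bold>\<in> \<omega> \<and> m \<^bold>\<in> \<omega> \<and> n \<^bold>\<in> \<omega> \<and> n \<noteq> \<^bold>0 \<and> k = pair_code l (pair_code m n) \<and>
      kadd (kmul q (ap \<iota> n)) (ap \<iota> m) = ap \<iota> l"
  show ?thesis
  proof (rule ctbl_rel[of ?R])
    show "Df (\<lambda>s. ?R (s 0) (s (Suc 0)))" by (intro df)
  next
    fix q assume "q \<^bold>\<in> K"
    then obtain l m n where lmn: "l \<^bold>\<in> \<omega>" "m \<^bold>\<in> \<omega>" "n \<^bold>\<in> \<omega>" "n \<noteq> \<^bold>0"
      and q: "q = (ap \<iota> l \<ominus>\<^bsub>Q\<^esub> ap \<iota> m) \<otimes>\<^bsub>Q\<^esub> inv\<^bsub>Q\<^esub> ap \<iota> n"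
      using frac ia by metis
    have "q \<otimes>\<^bsub>Q\<^esub> ap \<iota> n \<oplus>\<^bsub>Q\<^esub> ap \<iota> m = ap \<iota> l"
      unfolding q by (rule fraction_cleared) (use iK iU lmn in \<open>auto simp: Q_sel\<close>)
    then have "kadd (kmul q (ap \<iota> n)) (ap \<iota> m) = ap \<iota> l"
      using iK lmn \<open>q \<^bold>\<in> K\<close> by (simp add: kadd_kmul_eq)
    then show "\<exists>k. k \<^bold>\<in> \<omega> \<and> ?R k q"
      using lmn by (intro exI[of _ "pair_code l (pair_code m n)"] conjI exI[of _ l] exI[of _ m] exI[of _ n]) simp_all
  next
    fix k q q' assume q: "q \<^bold>\<in> K" "q' \<^bold>\<in> K" and "?R k q" and "?R k q'"
    from \<open>?R k q\<close> obtain l m n where 1: "l \<^bold>\<in> \<omega>" "m \<^bold>\<in> \<omega>" "n \<^bold>\<in> \<omega>" "n \<noteq> \<^bold>0" "k = pair_code l (pair_code m n)"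
      "kadd (kmul q (ap \<iota> n)) (ap \<iota> m) = ap \<iota> l" by blast
    from \<open>?R k q'\<close> obtain l' m' n' where 2: "l' \<^bold>\<in> \<omega>" "m' \<^bold>\<in> \<omega>" "n' \<^bold>\<in> \<omega>" "k = pair_code l' (pair_code m' n')"
      "kadd (kmul q' (ap \<iota> n')) (ap \<iota> m') = ap \<iota> l'" by blast
    have "l = l' \<and> pair_code m n = pair_code m' n'"
      by (rule pair_code_inject) (use 1(1-3,5) 2(1-4) in simp_all)
    then have "l = l' \<and> m = m' \<and> n = n'"
      using pair_code_inject[OF 1(2,3) 2(2,3)] by blast
    then have "q \<otimes>\<^bsub>Q\<^esub> ap \<iota> n \<oplus>\<^bsub>Q\<^esub> ap \<iota> m = q' \<otimes>\<^bsub>Q\<^esub> ap \<iota> n \<oplus>\<^bsub>Q\<^esub> ap \<iota> m"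
      using 1(6) 2(5) q iK 1(1-3) by (simp add: kadd_kmul_eq)
    then have "q \<otimes>\<^bsub>Q\<^esub> ap \<iota> n = q' \<otimes>\<^bsub>Q\<^esub> ap \<iota> n"
      using q iK[OF 1(2)] iK[OF 1(3)] Q.a_closed Q.m_closed by (simp add: Q_sel Q.add.right_cancel)
    then show "q = q'"
      using q iU[OF 1(3,4)] Q.m_rcancel[of "ap \<iota> n" q q'] nz[OF 1(3,4)] ia[OF 1(3)] iK[OF 1(3)]
      by (simp add: Q_sel)
  qed
qed

text \<open>
  Adding one basis vector \<open>b\<close> to \<open>D\<close> adds one rational coordinate, and there are only countably
  many rationals.
\<close>

lemma ctbl_supported:
  assumes "fin_basis D"
  shows "ctbl (coll V (supported D))"
  using assms
proof (induction rule: fin_induct)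
  case Df
  have "Df (\<lambda>s. supported (s (Suc 0)) (s 0))" by (intro df)
  then have "DT (\<lambda>s. coll V (supported (s 0)))" by (rule DT_coll[of "\<lambda>x D. supported D x"])
  then show ?case by (rule Df_ctbl)
next
  case empty
  have "Df (\<lambda>s. s 0 = \<^bold>0)" by (intro df)
  moreover have "x = zV" if "x \<^bold>\<in> coll V (supported \<^bold>0)" for x
    using that hyp_all_zero[of x] unfolding mem_supported by (auto simp: supported_def)
  ultimately show ?case
    by (intro ctbl_rel[of "\<lambda>k x. k = \<^bold>0"]) (assumption, use zero_in_omega in blast, metis)
next
  case (ins D b)
  have "DT (\<lambda>s. s 0 \<boxplus> s (Suc 0) \<boxdot> b)" by (intro df)
  moreover have "\<exists>h a. h \<^bold>\<in> coll V (supported D) \<and> a \<^bold>\<in> K \<and> v = h \<boxplus> a \<boxdot> b"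
    if "v \<^bold>\<in> coll V (supported (ins D b))" for v
  proof -
    have v: "v \<^bold>\<in> V" "\<And>c. c \<^bold>\<in> B \<Longrightarrow> \<not> c \<^bold>\<in> D \<Longrightarrow> c \<noteq> b \<Longrightarrow> hyperplane c v"
      using that unfolding mem_supported by (auto simp: supported_def)
    obtain h a where h: "hyperplane b h" "a \<^bold>\<in> K" "v = h \<boxplus> a \<boxdot> b" using hyp_decompose[OF ins(2) v(1)] by blast
    have V: "h \<^bold>\<in> V" "b \<^bold>\<in> V" using h(1) span_closed B_sub ins(2) unfolding hyperplane_def by blast+
    have "hyperplane c h" if c: "c \<^bold>\<in> B" "\<not> c \<^bold>\<in> D" for c
    proof (cases "c = b")
      case False
      have "hyperplane c (a \<boxdot> b \<boxplus> h)"
        using v(2)[OF c False] V h(2,3) vadd_commute[of h "a \<boxdot> b"] by simp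
      then show ?thesis
        using hyp_cancel[OF hyp_multiple[OF ins(2) not_sym[OF False] h(2)] _ V(1)] by blast
    qed (use h(1) in simp)
    then have "supported D h" using V(1) unfolding supported_def by blast
    then show ?thesis using h(2,3) unfolding mem_supported by blast
  qed
  ultimately show ?case
    by (rule ctbl_image2[OF ins(3) ctbl_scalars, of "\<lambda>h a. h \<boxplus> a \<boxdot> b"])
qed

section \<open>Weights\<close>

text \<open>
  Starting from the zero vector, \<open>n\<close> extensions give the vectors of weight at most \<open>n\<close>, that
  is, those with at most \<open>n\<close> support elements.
\<close>

definition extend_by_multiple :: "'m \<Rightarrow> 'm" where
  "extend_by_multiple Z = coll V (\<lambda>w. w \<^bold>\<in> Z \<or> (\<exists>z a b. z \<^bold>\<in> Z \<and> a \<^bold>\<in> K \<and> b \<^bold>\<in> B \<and> w = z \<boxplus> a \<boxdot> b))"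

definition weight_le :: "'m \<Rightarrow> 'm" where
  "weight_le n = recur (Pow_m V) extend_by_multiple (upair (\<^bold>\<in>) zV zV) n"

lemma mem_extend:
  "w \<^bold>\<in> extend_by_multiple Z \<longleftrightarrow> w \<^bold>\<in> V \<and> (w \<^bold>\<in> Z \<or> (\<exists>z a b. z \<^bold>\<in> Z \<and> a \<^bold>\<in> K \<and> b \<^bold>\<in> B \<and> w = z \<boxplus> a \<boxdot> b))"
  unfolding extend_by_multiple_def by (rule mem_coll) (intro df)

lemma DT_extend: "DT (\<lambda>s. extend_by_multiple (s 0))"
  unfolding extend_by_multiple_def
  by (rule DT_coll[of "\<lambda>w Z. w \<^bold>\<in> Z \<or> (\<exists>z a b. z \<^bold>\<in> Z \<and> a \<^bold>\<in> K \<and> b \<^bold>\<in> B \<and> w = z \<boxplus> a \<boxdot> b)"]) (intro df)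

lemma extend_closed: "extend_by_multiple Z \<^bold>\<in> Pow_m V"
  by (simp add: is_subset_def mem_extend)

lemma zero_set: "upair (\<^bold>\<in>) zV zV \<^bold>\<in> Pow_m V"
  by (simp add: is_subset_def)

lemma DT_weight [df]: "DT f \<Longrightarrow> DT (\<lambda>s. weight_le (f s))"
  unfolding weight_le_def by (rule DT_recur[OF DT_extend extend_closed DT_const])

lemma weight_zero: "w \<^bold>\<in> weight_le \<^bold>0 \<longleftrightarrow> w = zV"
  unfolding weight_le_def recur_zero[OF DT_extend extend_closed zero_set] by simp

lemma weight_V: "n \<^bold>\<in> \<omega> \<Longrightarrow> w \<^bold>\<in> weight_le n \<Longrightarrow> w \<^bold>\<in> V"
  using recur_closed[OF DT_extend extend_closed _ zero_set, of n]
  unfolding weight_le_def mem_Pow is_subset_def by blast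

lemma weight_succ:
  assumes "n \<^bold>\<in> \<omega>"
  shows "w \<^bold>\<in> weight_le (succ_m n) \<longleftrightarrow>
     w \<^bold>\<in> weight_le n \<or> (\<exists>z a b. z \<^bold>\<in> weight_le n \<and> a \<^bold>\<in> K \<and> b \<^bold>\<in> B \<and> w = z \<boxplus> a \<boxdot> b)"
proof -
  have eq: "weight_le (succ_m n) = extend_by_multiple (weight_le n)"
    unfolding weight_le_def by (rule recur_succ[OF DT_extend extend_closed assms zero_set])
  then show ?thesis
    using weight_V[OF assms] B_sub vadd_closed smul_closed unfolding eq mem_extend by blast
qed

text \<open>
  Among the summands of \<open>w\<close> there is a multiple of \<open>b\<close>, because all other summands lie in the
  hyperplane. Taking it out leaves one summand less. This takes the place of the pigeonhole
  principle for supports.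
\<close>

lemma weight_remove:
  assumes "n \<^bold>\<in> \<omega>" "b \<^bold>\<in> B"
  shows "\<forall>w. w \<^bold>\<in> weight_le (succ_m n) \<and> \<not> hyperplane b w \<longrightarrow>
    (\<exists>y a. y \<^bold>\<in> weight_le n \<and> a \<^bold>\<in> K \<and> w = y \<boxplus> a \<boxdot> b)"
  using assms(1)
proof (induction rule: omega_induct)
  case Df
  show ?case by (intro df)
next
  case zero
  show ?case
  proof (intro allI impI)
    fix w assume w: "w \<^bold>\<in> weight_le (succ_m \<^bold>0) \<and> \<not> hyperplane b w"
    then have "w \<noteq> zV" using hyp_zero by blast
    then obtain a c where "a \<^bold>\<in> K" "c \<^bold>\<in> B" "w = zV \<boxplus> a \<boxdot> c"
      using w unfolding weight_succ[OF zero_in_omega] weight_zero by blast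
    moreover from this have "c = b" using w hyp_multiple B_sub by auto
    ultimately show "\<exists>y a. y \<^bold>\<in> weight_le \<^bold>0 \<and> a \<^bold>\<in> K \<and> w = y \<boxplus> a \<boxdot> b"
      unfolding weight_zero by blast
  qed
next
  case (succ n)
  show ?case
  proof (intro allI impI)
    fix w assume w: "w \<^bold>\<in> weight_le (succ_m (succ_m n)) \<and> \<not> hyperplane b w"
    then consider "w \<^bold>\<in> weight_le (succ_m n)"
      | z a c where "z \<^bold>\<in> weight_le (succ_m n)" "a \<^bold>\<in> K" "c \<^bold>\<in> B" "w = z \<boxplus> a \<boxdot> c"
      unfolding weight_succ[OF succ_in_omega[OF succ(1)]] by blast
    then show "\<exists>y a. y \<^bold>\<in> weight_le (succ_m n) \<and> a \<^bold>\<in> K \<and> w = y \<boxplus> a \<boxdot> b"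
    proof cases
      case 1
      then show ?thesis using succ(2) w weight_succ[OF succ(1)] by blast
    next
      case 2
      show ?thesis
      proof (cases "c = b")
        case True
        then show ?thesis using 2 by blast
      next
        case False
        then have "\<not> hyperplane b z" using w 2(4) hyp_add hyp_multiple[OF 2(3) False 2(2)] by blast
        then obtain y k where y: "y \<^bold>\<in> weight_le n" "k \<^bold>\<in> K" "z = y \<boxplus> k \<boxdot> b"
          using succ(2) 2(1) by blast
        have "w = (y \<boxplus> a \<boxdot> c) \<boxplus> k \<boxdot> b"
          unfolding 2(4) y(3) using weight_V[OF succ(1) y(1)] y(2) 2(2,3) B_sub assms(2)
          by (simp add: vadd_ac)
        moreover have "y \<boxplus> a \<boxdot> c \<^bold>\<in> weight_le (succ_m n)"
          unfolding weight_succ[OF succ(1)] using y(1) 2(2,3) by blast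
        ultimately show ?thesis using y(2) by blast
      qed
    qed
  qed
qed

lemma weight_sum:
  assumes "n \<^bold>\<in> \<omega>" "m \<^bold>\<in> \<omega>"
  shows "\<exists>p. p \<^bold>\<in> \<omega> \<and> (\<forall>u v. u \<^bold>\<in> weight_le m \<and> v \<^bold>\<in> weight_le n \<longrightarrow> u \<boxplus> v \<^bold>\<in> weight_le p)"
  using assms(1)
proof (induction rule: omega_induct)
  case Df
  show ?case by (intro df)
next
  case zero
  show ?case using assms(2) weight_V[OF assms(2)] by (intro exI[of _ m]) (auto simp: weight_zero)
next
  case (succ n)
  then obtain p where p: "p \<^bold>\<in> \<omega>" "\<And>u v. u \<^bold>\<in> weight_le m \<Longrightarrow> v \<^bold>\<in> weight_le n \<Longrightarrow> u \<boxplus> v \<^bold>\<in> weight_le p" by blast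
  have "u \<boxplus> v \<^bold>\<in> weight_le (succ_m p)" if uv: "u \<^bold>\<in> weight_le m" "v \<^bold>\<in> weight_le (succ_m n)" for u v
  proof -
    consider "v \<^bold>\<in> weight_le n" | z a c where "z \<^bold>\<in> weight_le n" "a \<^bold>\<in> K" "c \<^bold>\<in> B" "v = z \<boxplus> a \<boxdot> c"
      using uv(2) unfolding weight_succ[OF succ(1)] by blast
    then show ?thesis
    proof cases
      case 1
      then show ?thesis using p(2)[OF uv(1)] unfolding weight_succ[OF p(1)] by blast
    next
      case 2
      have "u \<boxplus> v = (u \<boxplus> z) \<boxplus> a \<boxdot> c"
        unfolding 2(4) using weight_V[OF succ(1) 2(1)] weight_V[OF assms(2) uv(1)] 2(2,3) B_sub
        by (simp add: vadd_assoc)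
      then show ?thesis using p(2)[OF uv(1) 2(1)] 2(2,3) unfolding weight_succ[OF p(1)] by blast
    qed
  qed
  then show ?case using succ_in_omega[OF p(1)] by blast
qed

text \<open>
  If \<open>Z\<close> is the set of vectors of weight at most \<open>k\<close>, this is the set of those of weight
  at most \<open>2 k\<close>.
\<close>

definition doubled :: "'m \<Rightarrow> 'm" where
  "doubled Z = coll V (\<lambda>w. \<exists>u v. u \<^bold>\<in> Z \<and> v \<^bold>\<in> Z \<and> w = u \<boxplus> v)"

lemma mem_doubled: "w \<^bold>\<in> doubled Z \<longleftrightarrow> w \<^bold>\<in> V \<and> (\<exists>u v. u \<^bold>\<in> Z \<and> v \<^bold>\<in> Z \<and> w = u \<boxplus> v)"
  unfolding doubled_def by (rule mem_coll) (intro df)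

lemma DT_doubled0: "DT (\<lambda>s. doubled (s 0))"
  unfolding doubled_def by (rule DT_coll[of "\<lambda>w Z. \<exists>u v. u \<^bold>\<in> Z \<and> v \<^bold>\<in> Z \<and> w = u \<boxplus> v"]) (intro df)

lemmas DT_doubled [df] = DT_comp1[OF DT_doubled0]

lemma doubled_add: "Z \<^bold>\<subseteq> V \<Longrightarrow> u \<^bold>\<in> Z \<Longrightarrow> v \<^bold>\<in> Z \<Longrightarrow> u \<boxplus> v \<^bold>\<in> doubled Z"
  unfolding mem_doubled is_subset_def using vadd_closed by blast

lemma doubled_V: "doubled Z \<^bold>\<subseteq> V"
  by (simp add: is_subset_def mem_doubled)

lemma doubled_incl: "Z \<^bold>\<subseteq> V \<Longrightarrow> zV \<^bold>\<in> Z \<Longrightarrow> Z \<^bold>\<subseteq> doubled Z"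
  unfolding is_subset_def using doubled_add[of Z _ zV] vadd_zero(1) by (metis is_subset_def)

lemma doubled_weight:
  assumes "N \<^bold>\<in> \<omega>" "Z \<^bold>\<subseteq> weight_le N"
  shows "\<exists>p. p \<^bold>\<in> \<omega> \<and> doubled Z \<^bold>\<subseteq> weight_le p"
  using weight_sum[OF assms(1,1)] assms(2) unfolding is_subset_def mem_doubled by blast

text \<open>
  The vectors of weight at most \<open>4\<^sup>n\<close>.
\<close>

definition stage :: "'m \<Rightarrow> 'm" where
  "stage n = recur (Pow_m V) (\<lambda>Z. doubled (doubled Z)) (weight_le (succ_m \<^bold>0)) n"

lemma DT_quadrupled: "DT (\<lambda>s. doubled (doubled (s 0)))" by (intro df)

lemma quadrupled_closed: "doubled (doubled Z) \<^bold>\<in> Pow_m V" using doubled_V by simp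

lemma weight_one: "weight_le (succ_m \<^bold>0) \<^bold>\<in> Pow_m V"
  using weight_V[OF succ_in_omega[OF zero_in_omega]] by (simp add: is_subset_def)

lemma DT_stage [df]: "DT f \<Longrightarrow> DT (\<lambda>s. stage (f s))"
  unfolding stage_def by (rule DT_recur[OF DT_quadrupled quadrupled_closed DT_const])

lemma stage_zero: "stage \<^bold>0 = weight_le (succ_m \<^bold>0)"
  unfolding stage_def by (rule recur_zero[OF DT_quadrupled quadrupled_closed weight_one])

lemma stage_succ: "n \<^bold>\<in> \<omega> \<Longrightarrow> stage (succ_m n) = doubled (doubled (stage n))"
  unfolding stage_def by (rule recur_succ[OF DT_quadrupled quadrupled_closed _ weight_one])

lemma stage_V: "n \<^bold>\<in> \<omega> \<Longrightarrow> stage n \<^bold>\<subseteq> V"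
  using recur_closed[OF DT_quadrupled quadrupled_closed _ weight_one] unfolding stage_def by simp

lemma stage_has_zero: "n \<^bold>\<in> \<omega> \<Longrightarrow> zV \<^bold>\<in> stage n"
proof (induction rule: omega_induct)
  case Df
  show ?case by (intro df)
next
  case zero
  show ?case unfolding stage_zero weight_succ[OF zero_in_omega] weight_zero by blast
next
  case (succ n)
  then show ?case
    using doubled_incl[OF stage_V[OF succ(1)] succ(2)] doubled_incl[OF doubled_V, of "stage n"]
    unfolding stage_succ[OF succ(1)] is_subset_def by blast
qed

lemma stage_doubled: "n \<^bold>\<in> \<omega> \<Longrightarrow> stage n \<^bold>\<subseteq> doubled (stage n)"
  by (rule doubled_incl[OF stage_V stage_has_zero])

lemma doubled_stage: "n \<^bold>\<in> \<omega> \<Longrightarrow> doubled (stage n) \<^bold>\<subseteq> stage (succ_m n)"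
  using doubled_incl[OF doubled_V, of "stage n"] stage_doubled[of n] stage_has_zero[of n]
  unfolding stage_succ is_subset_def by simp

lemma stage_mono:
  assumes "n \<^bold>\<in> \<omega>"
  shows "\<forall>m. m \<^bold>\<in> n \<longrightarrow> doubled (stage m) \<^bold>\<subseteq> stage n"
  using assms
proof (induction rule: omega_induct)
  case Df
  show ?case by (intro df)
next
  case zero
  show ?case by simp
next
  case (succ n)
  then show ?case
    using stage_doubled[OF succ(1)] doubled_stage[OF succ(1)] unfolding is_subset_def mem_succ by blast
qed

lemma stage_cover:
  assumes "v \<^bold>\<in> V"
  shows "\<exists>n. n \<^bold>\<in> \<omega> \<and> v \<^bold>\<in> stage n"
  using assms
proof (induction rule: V_induct)
  case Df
  show ?case by (intro df)
next
  case zero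
  show ?case using stage_has_zero zero_in_omega by blast
next
  case (step v c a)
  then obtain n where n: "n \<^bold>\<in> \<omega>" "v \<^bold>\<in> stage n" by blast
  have "a \<boxdot> c \<^bold>\<in> stage m" if "m \<^bold>\<in> \<omega>" for m
    using that
  proof (induction rule: omega_induct)
    case Df
    show ?case by (intro df)
  next
    case zero
    have "a \<boxdot> c = zV \<boxplus> a \<boxdot> c" using step B_sub by simp
    then show ?case using step
      unfolding stage_zero weight_succ[OF zero_in_omega] weight_zero by blast
  next
    case (succ m)
    then show ?case using stage_doubled[of m] doubled_stage[of m] unfolding is_subset_def by blast
  qed
  then have "v \<boxplus> a \<boxdot> c \<^bold>\<in> doubled (stage n)" using doubled_add[OF stage_V[OF n(1)] n(2)] n(1) by blast
  then show ?case using doubled_stage[OF n(1)] succ_in_omega[OF n(1)] unfolding is_subset_def by blast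
qed

lemma stage_weight:
  assumes "n \<^bold>\<in> \<omega>"
  shows "\<exists>p. p \<^bold>\<in> \<omega> \<and> stage n \<^bold>\<subseteq> weight_le p"
  using assms
proof (induction rule: omega_induct)
  case Df
  show ?case by (intro df)
next
  case zero
  show ?case unfolding stage_zero is_subset_def using succ_in_omega[OF zero_in_omega] by blast
next
  case (succ n)
  then obtain p where "p \<^bold>\<in> \<omega>" "stage n \<^bold>\<subseteq> weight_le p" by blast
  then obtain p' where "p' \<^bold>\<in> \<omega>" "doubled (stage n) \<^bold>\<subseteq> weight_le p'" using doubled_weight by blast
  then show ?case using doubled_weight unfolding stage_succ[OF succ(1)] by blast
qed

section \<open>Finite sums from an uncountable set\<close>

abbreviation vsum :: "'m \<Rightarrow> 'm \<Rightarrow> bool" where "vsum \<equiv> sum_m (\<lambda>a. a)"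

lemma Df_vsum [df]: "DT f \<Longrightarrow> DT g \<Longrightarrow> Df (\<lambda>s. vsum (f s) (g s))"
  using Df_comp3[OF Df_sum0[of "\<lambda>p a. a", OF DT_var] DT_const] .

text \<open>
  Sums of distinct vectors of an uncountable set have unbounded weight, so a set \<open>Z\<close> of bounded
  weight cannot be closed under adding a further vector of \<open>Y\<close> to a sum. The closure hypothesis
  only speaks about sums already known to be in \<open>Z\<close>, which is what a monochromatic
  set provides.
\<close>

lemma uncountable_sums_escape:
  assumes Y: "Y \<^bold>\<subseteq> V" "\<not> ctbl Y" and N: "N \<^bold>\<in> \<omega>" "Z \<^bold>\<subseteq> weight_le N" and zero_Z: "zV \<^bold>\<in> Z"
    and closed: "\<And>F u x. F \<^bold>\<subseteq> Y \<Longrightarrow> vsum F u \<Longrightarrow> u \<^bold>\<in> Z \<Longrightarrow> x \<^bold>\<in> Y \<Longrightarrow> \<not> x \<^bold>\<in> F \<Longrightarrow> u \<boxplus> x \<^bold>\<in> Z"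
  shows False
proof -
  \<comment> \<open>\<open>u\<close> has more than \<open>n\<close> support elements outside \<open>D\<close>.\<close>
  define far where "far D n u \<longleftrightarrow> \<not> (\<exists>w d. w \<^bold>\<in> weight_le n \<and> supported D d \<and> u = w \<boxplus> d)" for D n u
  have pick: "\<exists>x. x \<^bold>\<in> Y \<and> \<not> supported D x" if "fin_basis D" for D
  proof (rule ccontr)
    assume "\<nexists>x. x \<^bold>\<in> Y \<and> \<not> supported D x"
    then have "Y \<^bold>\<subseteq> coll V (supported D)" unfolding is_subset_def mem_supported by blast
    then show False using ctbl_subset[OF ctbl_supported[OF that]] Y(2) by blast
  qed
  have add: "ins F x \<^bold>\<subseteq> Y \<and> vsum (ins F x) (u \<boxplus> x) \<and> u \<boxplus> x \<^bold>\<in> Z"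
    if "F \<^bold>\<subseteq> Y" "vsum F u" "u \<^bold>\<in> Z" "x \<^bold>\<in> Y" "\<not> x \<^bold>\<in> F" for F u x
  proof (intro conjI)
    show "ins F x \<^bold>\<subseteq> Y" using that(1,4) by (simp add: is_subset_def)
    show "vsum (ins F x) (u \<boxplus> x)"
      by (rule sum_insert[OF that(2,5)]) (use that(4) Y(1) in \<open>simp_all add: is_subset_def\<close>)
    show "u \<boxplus> x \<^bold>\<in> Z" by (rule closed[OF that])
  qed
  \<comment> \<open>Requiring the summands not to be supported in \<open>D\<close> guarantees, in the induction step, that the
    new vector \<open>x\<close> is not already one of the summands: it is supported in \<open>D'\<close>.\<close>
  have main: "\<forall>D. fin_basis D \<longrightarrow> (\<exists>F u. F \<^bold>\<subseteq> Y \<and> (\<forall>x. x \<^bold>\<in> F \<longrightarrow> \<not> supported D x) \<and>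
      vsum F u \<and> u \<^bold>\<in> Z \<and> far D n u)" if "n \<^bold>\<in> \<omega>" for n
    using that
  proof (induction rule: omega_induct)
    case Df
    show ?case unfolding far_def by (intro df)
  next
    case zero
    show ?case
    proof (intro allI impI)
      fix D assume "fin_basis D"
      then obtain x where x: "x \<^bold>\<in> Y" "\<not> supported D x" using pick by blast
      have xV: "x \<^bold>\<in> V" using x(1) Y(1) unfolding is_subset_def by blast
      have "ins \<^bold>0 x \<^bold>\<subseteq> Y \<and> vsum (ins \<^bold>0 x) (zV \<boxplus> x) \<and> zV \<boxplus> x \<^bold>\<in> Z"
        by (rule add[OF _ sum_empty zero_Z x(1)]) (simp_all add: is_subset_def)
      then have "ins \<^bold>0 x \<^bold>\<subseteq> Y \<and> vsum (ins \<^bold>0 x) x \<and> x \<^bold>\<in> Z" using xV by simp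
      moreover have "far D \<^bold>0 x"
        unfolding far_def weight_zero using x(2) by (auto simp: supported_def)
      ultimately show "\<exists>F u. F \<^bold>\<subseteq> Y \<and> (\<forall>x. x \<^bold>\<in> F \<longrightarrow> \<not> supported D x) \<and>
          vsum F u \<and> u \<^bold>\<in> Z \<and> far D \<^bold>0 u"
        using x(2) by (intro exI[of _ "ins \<^bold>0 x"] exI[of _ x]) simp
    qed
  next
    case (succ n)
    show ?case
    proof (intro allI impI)
      fix D assume D: "fin_basis D"
      then obtain x where x: "x \<^bold>\<in> Y" "\<not> supported D x" using pick by blast
      have xV: "x \<^bold>\<in> V" using x(1) Y(1) unfolding is_subset_def by blast
      obtain b where b: "b \<^bold>\<in> B" "\<not> b \<^bold>\<in> D" "\<not> hyperplane b x" using x(2) xV unfolding supported_def by blast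
      obtain D' where D': "fin_basis D'" "D \<^bold>\<subseteq> D'" "span D' x" using fin_span_exists[OF xV D] by blast
      have bD': "b \<^bold>\<in> D'" using span_hyp[OF D'(3)] b(3) by blast
      have bV: "b \<^bold>\<in> V" using B_sub[OF b(1)] .
      obtain F u where F: "F \<^bold>\<subseteq> Y" "\<And>x. x \<^bold>\<in> F \<Longrightarrow> \<not> supported D' x" and u: "vsum F u" "u \<^bold>\<in> Z" "far D' n u"
        using succ(2) D'(1) by blast
      have uV: "u \<^bold>\<in> V" using sum_closed[OF u(1)] .
      have xF: "\<not> x \<^bold>\<in> F" using F(2) span_supported[OF D'(3)] by blast
      \<comment> \<open>The coordinate at \<open>b\<close> is a support element outside \<open>D\<close> but inside \<open>D'\<close>, so it adds to the
        more than \<open>n\<close> support elements outside \<open>D'\<close>.\<close>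
      have far_succ: "far D (succ_m n) u'" if u': "\<not> hyperplane b u'" "far D' n u'" for u'
        unfolding far_def
      proof clarify
        fix w d assume w: "w \<^bold>\<in> weight_le (succ_m n)" and d: "supported D d" and eq: "u' = w \<boxplus> d"
        have "hyperplane b d" using d b unfolding supported_def by blast
        then have "\<not> hyperplane b w" using u'(1) eq hyp_add by blast
        then obtain y a where y: "y \<^bold>\<in> weight_le n" "a \<^bold>\<in> K" "w = y \<boxplus> a \<boxdot> b"
          using weight_remove[OF succ(1) b(1)] w by blast
        have V: "y \<^bold>\<in> V" "d \<^bold>\<in> V" using weight_V[OF succ(1) y(1)] d unfolding supported_def by blast+
        have "u' = y \<boxplus> (a \<boxdot> b \<boxplus> d)" unfolding eq y(3) using V bV y(2) by (simp add: vadd_assoc)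
        moreover have "supported D' (a \<boxdot> b \<boxplus> d)"
          by (rule supported_add[OF supported_multiple[OF bD' b(1) y(2)] supported_mono[OF d D'(2)]])
        ultimately show False using u'(2) y(1) unfolding far_def by blast
      qed
      have F': "\<not> supported D z" if "z \<^bold>\<in> F" for z
        using F(2)[OF that] supported_mono[OF _ D'(2)] by blast
      show "\<exists>F u. F \<^bold>\<subseteq> Y \<and> (\<forall>x. x \<^bold>\<in> F \<longrightarrow> \<not> supported D x) \<and> vsum F u \<and> u \<^bold>\<in> Z \<and> far D (succ_m n) u"
      \<comment> \<open>If \<open>b\<close> is in the support of \<open>u\<close>, then \<open>u\<close> itself works; otherwise adding \<open>x\<close> brings \<open>b\<close> in.\<close>
      proof (cases "hyperplane b u")
        case False
        then show ?thesis using far_succ[OF False u(3)] F(1) F' u(1,2) by blast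
      next
        case True
        have "far D' n (u \<boxplus> x)"
          unfolding far_def
        proof clarify
          fix w d assume w: "w \<^bold>\<in> weight_le n" and d: "supported D' d" and eq: "u \<boxplus> x = w \<boxplus> d"
          have V: "w \<^bold>\<in> V" "d \<^bold>\<in> V" using weight_V[OF succ(1) w] d unfolding supported_def by blast+
          have "u = u \<boxplus> (x \<boxplus> minus_one \<boxdot> x)" using vadd_minus_one[OF xV] uV by simp
          also have "\<dots> = (u \<boxplus> x) \<boxplus> minus_one \<boxdot> x" using uV xV by (simp add: vadd_assoc)
          also have "\<dots> = w \<boxplus> (d \<boxplus> minus_one \<boxdot> x)" unfolding eq using V xV by (simp add: vadd_assoc)
          finally have "u = w \<boxplus> (d \<boxplus> minus_one \<boxdot> x)" .
          moreover have "supported D' (d \<boxplus> minus_one \<boxdot> x)"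
            by (rule supported_add[OF d span_supported[OF span_smul[OF D'(3) minus_one_closed]]])
          ultimately show False using u(3) w unfolding far_def by blast
        qed
        moreover have "\<not> hyperplane b (u \<boxplus> x)" using hyp_cancel[OF True _ xV] b(3) by blast
        ultimately have "far D (succ_m n) (u \<boxplus> x)" using far_succ by blast
        moreover have "ins F x \<^bold>\<subseteq> Y \<and> vsum (ins F x) (u \<boxplus> x) \<and> u \<boxplus> x \<^bold>\<in> Z"
          by (rule add[OF F(1) u(1,2) x(1) xF])
        moreover have "\<not> supported D z" if "z \<^bold>\<in> ins F x" for z
          using that F' x(2) by auto
        ultimately show ?thesis by blast
      qed
    qed
  qed
  obtain F u where u: "vsum F u" "u \<^bold>\<in> Z" "far \<^bold>0 N u"
    using main[OF N(1)] fin_empty by blast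
  then have "u \<^bold>\<in> weight_le N" "u = u \<boxplus> zV" using N(2) sum_closed[OF u(1)] unfolding is_subset_def by auto
  then show False using u(3) supported_zero unfolding far_def by blast
qed

section \<open>The colouring\<close>

text \<open>
  The weight lies in an interval \<open>(4\<^sup>j, 2 \<cdot> 4\<^sup>j]\<close>.
\<close>

definition in_lower_shell :: "'m \<Rightarrow> bool" where
  "in_lower_shell v \<longleftrightarrow> (\<exists>j. j \<^bold>\<in> \<omega> \<and> v \<^bold>\<in> doubled (stage j) \<and> \<not> v \<^bold>\<in> stage j)"

lemma Df_in_lower_shell [df]: "DT f \<Longrightarrow> Df (\<lambda>s. in_lower_shell (f s))"
  by (rule Df_comp1[of in_lower_shell]) (unfold in_lower_shell_def, intro df)

text \<open>
  The intervals \<open>(4\<^sup>j, 2 \<cdot> 4\<^sup>j]\<close> with \<open>j > n\<close> start at \<open>4\<^sup>n\<^sup>+\<^sup>1\<close> or later, and those with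
  \<open>j \<le> n\<close> end at \<open>2 \<cdot> 4\<^sup>n\<close> or earlier.
\<close>

lemma stage_lower_shell:
  assumes "n \<^bold>\<in> \<omega>" "v \<^bold>\<in> stage (succ_m n)" "in_lower_shell v"
  shows "v \<^bold>\<in> doubled (stage n)"
proof -
  obtain j where j: "j \<^bold>\<in> \<omega>" "v \<^bold>\<in> doubled (stage j)" "\<not> v \<^bold>\<in> stage j"
    using assms(3) unfolding in_lower_shell_def by blast
  have "j = succ_m n \<or> j \<^bold>\<in> succ_m n \<or> succ_m n \<^bold>\<in> j"
    using omega_linear j(1) succ_in_omega[OF assms(1)] by blast
  moreover have "j \<noteq> succ_m n" using assms(2) j(3) by blast
  moreover have "\<not> succ_m n \<^bold>\<in> j"
  proof
    assume "succ_m n \<^bold>\<in> j"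
    then have "doubled (stage (succ_m n)) \<^bold>\<subseteq> stage j" using stage_mono[OF j(1)] by blast
    then show False
      using assms(2) j(3) stage_doubled[OF succ_in_omega[OF assms(1)]] unfolding is_subset_def by blast
  qed
  ultimately have "j \<^bold>\<in> n \<or> j = n" by simp
  then show ?thesis
    using j(2) stage_mono[OF assms(1)] stage_doubled[OF assms(1)] unfolding is_subset_def by blast
qed

text \<open>
  Let \<open>Y\<close> be the part of \<open>X\<close> of weight at most \<open>4\<^sup>n\<close>. If all sums have their weights in the lower
  shells, sums from \<open>Y\<close> cannot pass \<open>2 \<cdot> 4\<^sup>n\<close>: the next one has weight at most
  \<open>2 \<cdot> 4\<^sup>n + 4\<^sup>n\<close>, which is below \<open>4\<^sup>n\<^sup>+\<^sup>1\<close>. If no sum has its weight there, sums from \<open>Y\<close>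
  cannot pass \<open>4\<^sup>n\<close>, since the next one has weight at most \<open>2 \<cdot> 4\<^sup>n\<close>. In both cases \<open>Y\<close> is
  countable, as sums from an uncountable set have unbounded weight.
\<close>

lemma monochromatic_imp_ctbl:
  assumes DC: "DC (\<^bold>\<in>)" and X: "X \<^bold>\<subseteq> V"
    and mono: "\<And>F F' s s'. F \<^bold>\<subseteq> X \<Longrightarrow> F \<noteq> \<^bold>0 \<Longrightarrow> vsum F s \<Longrightarrow> F' \<^bold>\<subseteq> X \<Longrightarrow> F' \<noteq> \<^bold>0 \<Longrightarrow> vsum F' s' \<Longrightarrow>
      in_lower_shell s \<longleftrightarrow> in_lower_shell s'"
  shows "ctbl X"
proof (rule ctbl_increasing_union[OF DC, of "\<lambda>n x. x \<^bold>\<in> stage n"])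
  show "Df (\<lambda>s. s (Suc 0) \<^bold>\<in> stage (s 0))" by (intro df)
  show "x \<^bold>\<in> stage (succ_m n)" if "n \<^bold>\<in> \<omega>" "x \<^bold>\<in> X" "x \<^bold>\<in> stage n" for n x
    using that stage_doubled doubled_stage unfolding is_subset_def by blast
  show "\<exists>n. n \<^bold>\<in> \<omega> \<and> x \<^bold>\<in> stage n" if "x \<^bold>\<in> X" for x
    using stage_cover that X unfolding is_subset_def by blast
next
  fix n assume n: "n \<^bold>\<in> \<omega>"
  let ?Y = "coll X (\<lambda>x. x \<^bold>\<in> stage n)"
  have Y: "x \<^bold>\<in> ?Y \<longleftrightarrow> x \<^bold>\<in> X \<and> x \<^bold>\<in> stage n" for x
    by (rule mem_coll) (intro df)
  have YV: "?Y \<^bold>\<subseteq> V" using X unfolding is_subset_def Y by blast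
  have sum: "ins F x \<^bold>\<subseteq> X \<and> ins F x \<noteq> \<^bold>0 \<and> vsum (ins F x) (u \<boxplus> x)"
    if "F \<^bold>\<subseteq> ?Y" "vsum F u" "x \<^bold>\<in> ?Y" "\<not> x \<^bold>\<in> F" for F u x
  proof -
    have "ins F x \<noteq> \<^bold>0" using mem_ins[of x F x] mem_emp by metis
    moreover have "ins F x \<^bold>\<subseteq> X" using that(1,3) unfolding is_subset_def Y mem_ins by blast
    moreover have "vsum (ins F x) (u \<boxplus> x)"
      by (rule sum_insert[OF that(2,4)]) (use that(3) YV in \<open>simp_all add: is_subset_def\<close>)
    ultimately show ?thesis by blast
  qed
  show "ctbl ?Y"
  proof (rule ccontr)
    assume not_ctbl: "\<not> ctbl ?Y"
    obtain p where p: "p \<^bold>\<in> \<omega>" "stage n \<^bold>\<subseteq> weight_le p" using stage_weight[OF n] by blast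
    obtain p' where p': "p' \<^bold>\<in> \<omega>" "doubled (stage n) \<^bold>\<subseteq> weight_le p'" using doubled_weight[OF p] by blast
    have zdd: "zV \<^bold>\<in> doubled (stage n)"
      using stage_has_zero[OF n] stage_doubled[OF n] unfolding is_subset_def by blast
    show False
    proof (cases "\<exists>F s. F \<^bold>\<subseteq> X \<and> F \<noteq> \<^bold>0 \<and> vsum F s \<and> in_lower_shell s")
      case True
      show False
      proof (rule uncountable_sums_escape[OF YV not_ctbl p' zdd])
        fix F u x assume *: "F \<^bold>\<subseteq> ?Y" "vsum F u" "u \<^bold>\<in> doubled (stage n)" "x \<^bold>\<in> ?Y" "\<not> x \<^bold>\<in> F"
        have "in_lower_shell (u \<boxplus> x)" using True mono sum[OF *(1,2,4,5)] by blast
        moreover have "u \<boxplus> x \<^bold>\<in> stage (succ_m n)"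
          using doubled_add[OF doubled_V *(3)] *(4) stage_doubled[OF n] unfolding stage_succ[OF n] Y is_subset_def by blast
        ultimately show "u \<boxplus> x \<^bold>\<in> doubled (stage n)" using stage_lower_shell[OF n] by blast
      qed
    next
      case False
      show False
      proof (rule uncountable_sums_escape[OF YV not_ctbl p stage_has_zero[OF n]])
        fix F u x assume *: "F \<^bold>\<subseteq> ?Y" "vsum F u" "u \<^bold>\<in> stage n" "x \<^bold>\<in> ?Y" "\<not> x \<^bold>\<in> F"
        have "\<not> in_lower_shell (u \<boxplus> x)" using False sum[OF *(1,2,4,5)] by blast
        moreover have "u \<boxplus> x \<^bold>\<in> doubled (stage n)"
          using doubled_add[OF stage_V[OF n] *(3)] *(4) unfolding Y by blast
        ultimately show "u \<boxplus> x \<^bold>\<in> stage n" using n unfolding in_lower_shell_def by blast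
      qed
    qed
  qed
qed

lemma mem_FS:
  assumes "X \<^bold>\<subseteq> V"
  shows "s \<in> FS (\<^bold>\<in>) V pV zV X \<longleftrightarrow> (\<exists>F. F \<^bold>\<subseteq> X \<and> F \<noteq> \<^bold>0 \<and> vsum F s)"
proof -
  have "is_sum (\<^bold>\<in>) V pV zV F (\<lambda>a. a) s \<longleftrightarrow> vsum F s" if "F \<^bold>\<subseteq> X" for F
    by (rule is_sum_iff) (use that assms in \<open>auto simp: is_subset_def\<close>)
  then show ?thesis unfolding FS_def by blast
qed

lemma good_colouring:
  assumes DC: "DC (\<^bold>\<in>)"
  shows "\<exists>c. fun_m c V (two (\<^bold>\<in>)) \<and>
    \<not> (\<exists>X. X \<^bold>\<subseteq> V \<and> uncountable (\<^bold>\<in>) X \<and> monochromatic (\<^bold>\<in>) c (FS (\<^bold>\<in>) V pV zV X))"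
proof -
  have "DT (\<lambda>s. if in_lower_shell (s 0) then succ_m \<^bold>0 else \<^bold>0)" by (intro df)
  moreover have "(if in_lower_shell v then succ_m \<^bold>0 else \<^bold>0) \<^bold>\<in> two (\<^bold>\<in>)" for v
    by (simp add: two_def)
  ultimately obtain c where c: "fun_m c V (two (\<^bold>\<in>))"
    "\<And>v. v \<^bold>\<in> V \<Longrightarrow> ap c v = (if in_lower_shell v then succ_m \<^bold>0 else \<^bold>0)"
    using fun_exists[of "\<lambda>v. if in_lower_shell v then succ_m \<^bold>0 else \<^bold>0" V "two (\<^bold>\<in>)"] by blast
  have "ctbl X" if X: "X \<^bold>\<subseteq> V" and m: "monochromatic (\<^bold>\<in>) c (FS (\<^bold>\<in>) V pV zV X)" for X
  proof (rule monochromatic_imp_ctbl[OF DC X])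
    fix F F' s s'
    assume *: "F \<^bold>\<subseteq> X" "F \<noteq> \<^bold>0" "vsum F s" "F' \<^bold>\<subseteq> X" "F' \<noteq> \<^bold>0" "vsum F' s'"
    have "app_m c s = app_m c s'"
      using m * mem_FS[OF X] unfolding monochromatic_def by blast
    then have "ap c s = ap c s'" using fun_app(2)[OF c(1)] sum_closed * by metis
    then show "in_lower_shell s \<longleftrightarrow> in_lower_shell s'"
      using c(2) sum_closed[OF *(3)] sum_closed[OF *(6)] by (auto split: if_splits)
  qed
  then show ?thesis using c(1) unfolding uncountable_iff by blast
qed

end

theorem theorem2p11:
  fixes E :: "'m \<Rightarrow> 'm \<Rightarrow> bool"
    and K pK tK zK eK V pV zV sV :: 'm
  assumes "ZF E" and "DC E"
    and "is_rat_vector_space E K pK tK zK eK V pV zV sV"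
    and "\<exists>B. is_basis E K zK V pV zV sV B"
  shows "\<exists>c. is_fun E c V (two E) \<and>
           \<not> (\<exists>X. is_subset E X V \<and> uncountable E X \<and> monochromatic E c (FS E V pV zV X))"
proof -
  obtain B where "is_basis E K zK V pV zV sV B" using assms(4) by blast
  then interpret rational_space E K pK tK zK eK V pV zV sV B
    using assms by unfold_locales
  show ?thesis by (rule good_colouring[OF assms(2)])
qed

end
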